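(* Let $G$ be any of the Lie groups $N_2,N_3,N_4,N_5,N_6,N_8$ (listed in the context) endowed with a left-invariant complex structure $J$ as in the context for which $K_1\neq0$, i.e. $\rho+\lambda^2-2x\neq0$. Then, for appropriate choices of the Gauduchon parameter $\tau$, the slope parameter $\alpha'$ and the initial metrics, $(G,J)$ admits both immortal and ancient left-invariant solutions to the Anomaly flow $$\partial_t(\Vert\Psi\Vert_{\omega_t}\omega_t^2)= i\partial\overline\partial\omega_t-\frac{\alpha'}{4}\mathrm{Tr}(Rm^\tau_t\wedge Rm^\tau_t).$$
   Context: The groups $N_k$ are the simply connected nilpotent Lie groups with Lie algebras (in terms of a basis of $1$-forms $e^1,\dots,e^6$, the tuple listing $de^1,\dots,de^6$, with $12$ meaning $e^1\wedge e^2$): $\mathfrak n_2=(0,0,0,0,12,34)$, $\mathfrak n_3=(0,0,0,0,0,12+34)$, $\mathfrak n_4=(0,0,0,0,12,14+23)$, $\mathfrak n_5=(0,0,0,0,13+42,14+23)$, $\mathfrak n_6=(0,0,0,0,12,13)$, $\mathfrak n_8=(0,0,0,0,0,12)$. These are the groups admitting a left-invariant complex structure $J$ with a left-invariant $(1,0)$-coframe $\{\zeta^1,\zeta^2,\zeta^3\}$ such that $d\zeta^1=d\zeta^2=0$, $d\zeta^3=\rho\,\zeta^{12}+\zeta^{1\bar1}+\lambda\,\zeta^{1\bar2}+(x+iy)\,\zeta^{2\bar2}$ ($x,y,\lambda\in\mathbb R$, $\lambda\ge0$, $\rho\in\{0,1\}$, $\zeta^{i\bar j}=\zeta^i\wedge\overline{\zeta^j}$).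 $\Psi=\zeta^1\wedge\zeta^2\wedge\zeta^3$; for $\omega=\frac i2\sum h_{j\bar l}\zeta^{j\bar l}$, $\Vert\Psi\Vert^2_\omega=8/\det(h_{j\bar l})$. $Rm^\tau_t$ is the curvature of the Gauduchon connection $\nabla^\tau=\frac{1+\tau}2\nabla^1+\frac{1-\tau}2\nabla^{-1}$ of $\omega_t$ ($\nabla^1$ Chern, $\nabla^{-1}$ Strominger–Bismut, i.e. the Hermitian connection with totally skew torsion); $\mathrm{Tr}(\Omega\wedge\Omega)=\sum_{i<j}\Omega^i_j\wedge\Omega^i_j$ in a real orthonormal frame. The flow reduces to an ODE $\frac{d}{dt}r(t)^2=K_1+\frac{K_2}{r(t)^4}$, where $K_1$ is a positive multiple (depending on $\omega_0$) of $\rho+\lambda^2-2x$. A solution on its maximal interval of definition $(T^-,T^+)\ni0$ is immortal if $(T^-,T^+)=(-\varepsilon,+\infty)$ and ancient if $(T^-,T^+)=(-\infty,\varepsilon)$, for some $\varepsilon>0$. *)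

theory Defs
  imports "HOL-Analysis.Analysis" "HOL-Combinatorics.Permutations"
begin

text \<open>
  Left-invariant tensors on a simply connected Lie group are identified with tensors on its Lie
  algebra; all the Lie algebras below have underlying space \<open>real ^ 6\<close>, with the bracket passed as
  a parameter \<open>br\<close>.  In the index type \<open>6\<close> the numeral \<open>6\<close> equals \<open>0\<close>, so \<open>1, ..., 6\<close> are its six
  elements.
\<close>

type_synonym V6 = "real ^ 6"

section \<open>The Lie algebras\<close>

definition e2 :: "6 \<Rightarrow> 6 \<Rightarrow> V6 \<Rightarrow> V6 \<Rightarrow> real" where
  "e2 i j u v = u $ i * v $ j - u $ j * v $ i"

text \<open>The tuple of the values of \<open>de^1, ..., de^6\<close> on \<open>u, v\<close>.\<close>

definition de_tuple :: "nat \<Rightarrow> V6 \<Rightarrow> V6 \<Rightarrow> V6" where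
  "de_tuple k u v = vector
    (if k = 2 then [0, 0, 0, 0, e2 1 2 u v, e2 3 4 u v]
     else if k = 3 then [0, 0, 0, 0, 0, e2 1 2 u v + e2 3 4 u v]
     else if k = 4 then [0, 0, 0, 0, e2 1 2 u v, e2 1 4 u v + e2 2 3 u v]
     else if k = 5 then [0, 0, 0, 0, e2 1 3 u v + e2 4 2 u v, e2 1 4 u v + e2 2 3 u v]
     else if k = 6 then [0, 0, 0, 0, e2 1 2 u v, e2 1 3 u v]
     else if k = 8 then [0, 0, 0, 0, 0, e2 1 2 u v]
     else [0, 0, 0, 0, 0, 0])"

text \<open>\<open>de^k(u, v) = - e^k([u, v])\<close> for left-invariant 1-forms.\<close>

definition nil_bracket :: "nat \<Rightarrow> V6 \<Rightarrow> V6 \<Rightarrow> V6" where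
  "nil_bracket k u v = - de_tuple k u v"

section \<open>Left-invariant complex-valued forms\<close>

text \<open>
  A \<open>k\<close>-form is represented by its values on lists of \<open>k\<close> vectors; values on lists of any other
  length carry no meaning.
\<close>

type_synonym form = "V6 list \<Rightarrow> complex"

definition one_form :: "(V6 \<Rightarrow> complex) \<Rightarrow> form" where
  "one_form f vs = f (hd vs)"

text \<open>
  Wedge product of a \<open>p\<close>-form with a form of degree \<open>length vs - p\<close>, normalised so that
  \<open>(a \<and> b)(u, v) = a(u) b(v) - a(v) b(u)\<close> for 1-forms.
\<close>

definition wedge :: "nat \<Rightarrow> form \<Rightarrow> form \<Rightarrow> form" where
  "wedge p \<alpha> \<beta> vs =
    (\<Sum>\<sigma> | \<sigma> permutes {..<length vs}. of_int (sign \<sigma>)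
        * \<alpha> (map (\<lambda>i. vs ! \<sigma> i) [0..<p]) * \<beta> (map (\<lambda>i. vs ! \<sigma> i) [p..<length vs]))
    / (fact p * fact (length vs - p))"

text \<open>
  The exterior derivative of left-invariant forms (Chevalley--Eilenberg differential):
  \<open>d\<alpha>(v_0, ..., v_k)\<close> is the sum over \<open>i < j\<close> of
  \<open>(-1)^(i+j) \<alpha>([v_i, v_j], v_0, ..., v_k)\<close> with \<open>v_i, v_j\<close> omitted from the tail.
\<close>

definition ext_d :: "(V6 \<Rightarrow> V6 \<Rightarrow> V6) \<Rightarrow> form \<Rightarrow> form" where
  "ext_d br \<alpha> vs =
    (\<Sum>(i, j) \<in> {(i, j). i < j \<and> j < length vs}.
      (- 1) ^ (i + j) * \<alpha> (br (vs ! i) (vs ! j) # nths vs (- {i, j})))"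

text \<open>
  \<open>bideg_part J p \<alpha>\<close> is the component of bidegree \<open>(p, k - p)\<close> of a \<open>k\<close>-form \<open>\<alpha>\<close>: the complex
  multilinear extension of \<open>\<alpha>\<close> is evaluated with \<open>p\<close> of the arguments replaced by their
  \<open>(1,0)\<close>-parts \<open>(v - \<i>Jv)/2\<close> and the others by their \<open>(0,1)\<close>-parts \<open>(v + \<i>Jv)/2\<close>, and the results
  are summed over all choices of the \<open>p\<close> positions.
\<close>

definition insert10 :: "(V6 \<Rightarrow> V6) \<Rightarrow> V6 \<Rightarrow> form \<Rightarrow> form" where
  "insert10 J v \<alpha> vs = (\<alpha> (v # vs) - \<i> * \<alpha> (J v # vs)) / 2"

definition insert01 :: "(V6 \<Rightarrow> V6) \<Rightarrow> V6 \<Rightarrow> form \<Rightarrow> form" where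
  "insert01 J v \<alpha> vs = (\<alpha> (v # vs) + \<i> * \<alpha> (J v # vs)) / 2"

fun bideg_part :: "(V6 \<Rightarrow> V6) \<Rightarrow> nat \<Rightarrow> form \<Rightarrow> form" where
  "bideg_part J 0 \<alpha> [] = \<alpha> []"
| "bideg_part J (Suc p) \<alpha> [] = 0"
| "bideg_part J 0 \<alpha> (v # vs) = bideg_part J 0 (insert01 J v \<alpha>) vs"
| "bideg_part J (Suc p) \<alpha> (v # vs) =
     bideg_part J p (insert10 J v \<alpha>) vs + bideg_part J (Suc p) (insert01 J v \<alpha>) vs"

text \<open>The operators \<open>\<partial>\<close> and \<open>\<partial>\<close>-bar on forms of bidegree \<open>(p, q)\<close> (any \<open>q\<close>).\<close>

definition del :: "(V6 \<Rightarrow> V6 \<Rightarrow> V6) \<Rightarrow> (V6 \<Rightarrow> V6) \<Rightarrow> nat \<Rightarrow> form \<Rightarrow> form" where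
  "del br J p \<alpha> = bideg_part J (Suc p) (ext_d br \<alpha>)"

definition delbar :: "(V6 \<Rightarrow> V6 \<Rightarrow> V6) \<Rightarrow> (V6 \<Rightarrow> V6) \<Rightarrow> nat \<Rightarrow> form \<Rightarrow> form" where
  "delbar br J p \<alpha> = bideg_part J p (ext_d br \<alpha>)"

section \<open>Complex structures and their coframes\<close>

definition complex_structure :: "(V6 \<Rightarrow> V6 \<Rightarrow> V6) \<Rightarrow> (V6 \<Rightarrow> V6) \<Rightarrow> bool" where
  "complex_structure br J \<longleftrightarrow> linear J \<and> (\<forall>v. J (J v) = - v) \<and>
    (\<forall>u v. br u v + J (br (J u) v) + J (br u (J v)) - br (J u) (J v) = 0)"

definition coframe10 :: "(V6 \<Rightarrow> V6) \<Rightarrow> (3 \<Rightarrow> V6 \<Rightarrow> complex) \<Rightarrow> bool" where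
  "coframe10 J \<zeta> \<longleftrightarrow> (\<forall>j. linear (\<zeta> j) \<and> (\<forall>v. \<zeta> j (J v) = \<i> * \<zeta> j v)) \<and>
    (\<forall>c. (\<forall>v. (\<Sum>j\<in>UNIV. c j * \<zeta> j v) = 0) \<longrightarrow> (\<forall>j. c j = 0))"

definition z_z :: "(3 \<Rightarrow> V6 \<Rightarrow> complex) \<Rightarrow> 3 \<Rightarrow> 3 \<Rightarrow> form" where
  "z_z \<zeta> i j = wedge 1 (one_form (\<zeta> i)) (one_form (\<zeta> j))"

definition z_zbar :: "(3 \<Rightarrow> V6 \<Rightarrow> complex) \<Rightarrow> 3 \<Rightarrow> 3 \<Rightarrow> form" where
  "z_zbar \<zeta> i j = wedge 1 (one_form (\<zeta> i)) (one_form (\<lambda>v. cnj (\<zeta> j v)))"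

definition structure_equations ::
  "(V6 \<Rightarrow> V6 \<Rightarrow> V6) \<Rightarrow> (3 \<Rightarrow> V6 \<Rightarrow> complex) \<Rightarrow> real \<Rightarrow> real \<Rightarrow> real \<Rightarrow> real \<Rightarrow> bool" where
  "structure_equations br \<zeta> \<rho> lam x y \<longleftrightarrow>
    (\<forall>u v. ext_d br (one_form (\<zeta> 1)) [u, v] = 0 \<and>
           ext_d br (one_form (\<zeta> 2)) [u, v] = 0 \<and>
           ext_d br (one_form (\<zeta> 3)) [u, v] =
             of_real \<rho> * z_z \<zeta> 1 2 [u, v] + z_zbar \<zeta> 1 1 [u, v]
             + of_real lam * z_zbar \<zeta> 1 2 [u, v] + Complex x y * z_zbar \<zeta> 2 2 [u, v])"

section \<open>Left-invariant Hermitian metrics\<close>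

text \<open>
  In terms of a \<open>(1,0)\<close>-coframe, left-invariant Hermitian metrics correspond to positive definite
  Hermitian matrices \<open>h\<close>.
\<close>

definition positive_hermitian :: "complex ^ 3 ^ 3 \<Rightarrow> bool" where
  "positive_hermitian h \<longleftrightarrow> (\<forall>j l. h $ l $ j = cnj (h $ j $ l)) \<and>
    (\<forall>z :: complex ^ 3. z \<noteq> 0 \<longrightarrow> 0 < Re (\<Sum>j\<in>UNIV. \<Sum>l\<in>UNIV. h $ j $ l * z $ j * cnj (z $ l)))"

definition fundamental_form :: "(3 \<Rightarrow> V6 \<Rightarrow> complex) \<Rightarrow> complex ^ 3 ^ 3 \<Rightarrow> form" where
  "fundamental_form \<zeta> h vs = \<i> / 2 * (\<Sum>j\<in>UNIV. \<Sum>l\<in>UNIV. h $ j $ l * z_zbar \<zeta> j l vs)"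

definition riem_metric :: "(V6 \<Rightarrow> V6) \<Rightarrow> form \<Rightarrow> V6 \<Rightarrow> V6 \<Rightarrow> real" where
  "riem_metric J \<omega> u v = Re (\<omega> [u, J v])"

text \<open>The norm of \<open>\<Psi> = \<zeta>^1 \<and> \<zeta>^2 \<and> \<zeta>^3\<close>; the determinant of a Hermitian matrix is real.\<close>

definition Psi_norm :: "complex ^ 3 ^ 3 \<Rightarrow> real" where
  "Psi_norm h = sqrt (8 / Re (det h))"

section \<open>Gauduchon connections and their curvature\<close>

definition torsion :: "(V6 \<Rightarrow> V6 \<Rightarrow> V6) \<Rightarrow> (V6 \<Rightarrow> V6 \<Rightarrow> V6) \<Rightarrow> V6 \<Rightarrow> V6 \<Rightarrow> V6" where
  "torsion br D u v = D u v - D v u - br u v"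

definition hermitian_connection ::
  "(V6 \<Rightarrow> V6) \<Rightarrow> (V6 \<Rightarrow> V6 \<Rightarrow> real) \<Rightarrow> (V6 \<Rightarrow> V6 \<Rightarrow> V6) \<Rightarrow> bool" where
  "hermitian_connection J g D \<longleftrightarrow> bilinear D \<and>
    (\<forall>u v w. g (D u v) w + g v (D u w) = 0) \<and> (\<forall>u v. D u (J v) = J (D u v))"

text \<open>The Chern connection is the Hermitian connection whose torsion has no \<open>(1,1)\<close>-component.\<close>

definition is_chern ::
  "(V6 \<Rightarrow> V6 \<Rightarrow> V6) \<Rightarrow> (V6 \<Rightarrow> V6) \<Rightarrow> (V6 \<Rightarrow> V6 \<Rightarrow> real) \<Rightarrow> (V6 \<Rightarrow> V6 \<Rightarrow> V6) \<Rightarrow> bool" where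
  "is_chern br J g D \<longleftrightarrow> hermitian_connection J g D \<and>
    (\<forall>u v. torsion br D (J u) (J v) = - torsion br D u v)"

definition is_bismut ::
  "(V6 \<Rightarrow> V6 \<Rightarrow> V6) \<Rightarrow> (V6 \<Rightarrow> V6) \<Rightarrow> (V6 \<Rightarrow> V6 \<Rightarrow> real) \<Rightarrow> (V6 \<Rightarrow> V6 \<Rightarrow> V6) \<Rightarrow> bool" where
  "is_bismut br J g D \<longleftrightarrow> hermitian_connection J g D \<and>
    (\<forall>u v w. g (torsion br D u v) w = - g (torsion br D u w) v)"

definition chern_connection ::
  "(V6 \<Rightarrow> V6 \<Rightarrow> V6) \<Rightarrow> (V6 \<Rightarrow> V6) \<Rightarrow> (V6 \<Rightarrow> V6 \<Rightarrow> real) \<Rightarrow> V6 \<Rightarrow> V6 \<Rightarrow> V6" where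
  "chern_connection br J g = (THE D. is_chern br J g D)"

definition bismut_connection ::
  "(V6 \<Rightarrow> V6 \<Rightarrow> V6) \<Rightarrow> (V6 \<Rightarrow> V6) \<Rightarrow> (V6 \<Rightarrow> V6 \<Rightarrow> real) \<Rightarrow> V6 \<Rightarrow> V6 \<Rightarrow> V6" where
  "bismut_connection br J g = (THE D. is_bismut br J g D)"

text \<open>The definite descriptions above are unambiguous:\<close>

lemma hermitian_difference:
  assumes "bilinear g" "linear J" "hermitian_connection J g D" "hermitian_connection J g D'"
  defines "A \<equiv> \<lambda>u v. D u v - D' u v"
  shows "bilinear A" "A u (J v) = J (A u v)" "g (A u v) w = - g v (A u w)"
proof -
  have D: "bilinear D" "bilinear D'" "\<And>u v. D u (J v) = J (D u v)" "\<And>u v. D' u (J v) = J (D' u v)"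
      "\<And>u v w. g (D u v) w + g v (D u w) = 0" "\<And>u v w. g (D' u v) w + g v (D' u w) = 0"
    using assms(3,4) by (auto simp: hermitian_connection_def)
  show "bilinear A" using D(1,2) by (auto simp: A_def bilinear_def intro: linear_compose_sub)
  show "A u (J v) = J (A u v)" by (simp add: A_def D(3,4) linear_diff[OF assms(2)])
  show "g (A u v) w = - g v (A u w)"
    using D(5)[of u v w] D(6)[of u v w]
    by (simp add: A_def bilinear_lsub[OF assms(1)] bilinear_rsub[OF assms(1)])
qed

lemma is_chern_unique:
  assumes g: "bilinear g" "\<And>v. v \<noteq> 0 \<Longrightarrow> 0 < g v v" "\<And>u v. g (J u) (J v) = g u v"
    and J: "linear J" "\<And>v. J (J v) = - v"
    and D: "is_chern br J g D" "is_chern br J g D'"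
  shows "D = D'"
proof -
  define A where "A = (\<lambda>u v. D u v - D' u v)"
  have h: "hermitian_connection J g D" "hermitian_connection J g D'"
    using D by (auto simp: is_chern_def)
  have A: "bilinear A" "\<And>u v. A u (J v) = J (A u v)" "\<And>u v w. g (A u v) w = - g v (A u w)"
    using hermitian_difference[OF g(1) J(1) h] unfolding A_def by blast+
  note lin = bilinear_ladd[OF A(1)] bilinear_lneg[OF A(1)] linear_add[OF J(1)] linear_neg[OF J(1)]
  have T: "A (J u) (J v) + A u v = A (J v) (J u) + A v u" for u v
  proof -
    have "torsion br D (J u) (J v) - torsion br D' (J u) (J v)
        = - (torsion br D u v - torsion br D' u v)"
      using D by (simp add: is_chern_def)
    then show ?thesis by (simp add: torsion_def A_def algebra_simps)
  qed
  define B where "B u v = A (J u) (J v) + A u v" for u v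
  have Bs: "B u v = B v u" for u v using T by (simp add: B_def)
  have Br: "B u (J v) = J (B u v)" for u v by (simp add: B_def A(2) lin)
  have Bl: "B (J u) v = - J (B u v)" for u v by (simp add: B_def A(2) lin J(2))
  have B0: "B u v = 0" for u v
  proof -
    have "J (B u v) = B (J v) u" using Br[of u v] Bs[of u "J v"] by (rule subst)
    also have "\<dots> = - J (B u v)" unfolding Bl Bs[of v u] ..
    finally have "J (B u v) = - J (B u v)" .
    then have "J (B u v) + J (B u v) = 0" by (rule eq_neg_iff_add_eq_0[THEN iffD1])
    then have "2 *\<^sub>R J (B u v) = 0" by (simp only: scaleR_2)
    then have "J (B u v) = 0" by simp
    then have "J (J (B u v)) = 0" by (simp add: linear_0[OF J(1)])
    then show ?thesis by (simp add: J(2))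
  qed
  have AJ: "A (J u) v = J (A u v)" for u v
  proof -
    have "J (A (J u) v) + A u v = 0" using B0[of u v] by (simp add: B_def A(2))
    then have "J (J (A (J u) v) + A u v) = 0" by (simp add: linear_0[OF J(1)])
    then show ?thesis by (simp add: lin J(2))
  qed
  have "A u v = 0" for u v
  proof (rule ccontr)
    assume "A u v \<noteq> 0"
    define w where "w = J (A u v)"
    have gJ: "g (J a) b = - g a (J b)" for a b
      using g(3)[of a "J b"] by (simp add: J(2) bilinear_rneg[OF g(1)])
    have "g (A (J u) v) w = - g v (A (J u) w)" by (rule A(3))
    then have "g (J (A u v)) w = - g v (J (A u w))" by (simp add: AJ)
    also have "\<dots> = g (J v) (A u w)" by (simp add: gJ)
    also have "\<dots> = - g (A u (J v)) w" by (simp add: A(3))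
    also have "\<dots> = - g (J (A u v)) w" by (simp add: A(2))
    finally have "g w w = 0" by (simp add: w_def)
    then have "w = 0" using g(2)[of w] by (cases "w = 0") simp_all
    then have "A u v = 0"
      using J(2)[of "A u v"] by (simp add: w_def linear_0[OF J(1)])
    with \<open>A u v \<noteq> 0\<close> show False by simp
  qed
  then show ?thesis by (simp add: A_def fun_eq_iff)
qed

lemma is_bismut_unique:
  assumes g: "bilinear g" "\<And>u v. g u v = g v u" "\<And>v. v \<noteq> 0 \<Longrightarrow> 0 < g v v"
      "\<And>u v. g (J u) (J v) = g u v"
    and J: "linear J" "\<And>v. J (J v) = - v"
    and D: "is_bismut br J g D" "is_bismut br J g D'"
  shows "D = D'"
proof -
  define A where "A = (\<lambda>u v. D u v - D' u v)"
  have h: "hermitian_connection J g D" "hermitian_connection J g D'"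
    using D by (auto simp: is_bismut_def)
  have A: "bilinear A" "\<And>u v. A u (J v) = J (A u v)" "\<And>u v w. g (A u v) w = - g v (A u w)"
    using hermitian_difference[OF g(1) J(1) h] unfolding A_def by blast+
  define a where "a u v w = g (A u v) w" for u v w
  have skew: "a u v w = - a u w v" for u v w
    unfolding a_def A(3)[of u v w] g(2)[of v "A u w"] ..
  have T: "a u v w - a v u w = - (a u w v - a w u v)" for u v w
  proof -
    have "g (torsion br D u v - torsion br D' u v) w = - g (torsion br D u w - torsion br D' u w) v"
    proof -
      have "g (torsion br D u v) w = - g (torsion br D u w) v"
        "g (torsion br D' u v) w = - g (torsion br D' u w) v"
        using D unfolding is_bismut_def by blast+
      then show ?thesis unfolding bilinear_lsub[OF g(1)] by linarith
    qed
    moreover have "torsion br D x y - torsion br D' x y = A x y - A y x" for x y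
      by (simp add: torsion_def A_def)
    ultimately show ?thesis by (simp add: a_def bilinear_lsub[OF g(1)])
  qed
  have cyc: "a u v w = a v w u" for u v w
    using T[of w u v] T[of v u w] T[of u v w] skew[of u v w] skew[of v w u] skew[of w u v]
    by linarith
  have gJ: "g (J a) b = - g a (J b)" for a b
    using g(4)[of a "J b"] by (simp add: J(2) bilinear_rneg[OF g(1)])
  have Js: "a u (J v) w = - a u v (J w)" for u v w by (simp add: a_def A(2) gJ)
  have "A u v = 0" for u v
  proof (rule ccontr)
    assume ne: "A u v \<noteq> 0"
    have z: "a u v (J w) = 0" for w
      using Js[of u v w] Js[of w u v] Js[of v w u]
        cyc[of u v "J w"] cyc[of "J u" v w] cyc[of w "J u" v] cyc[of w u "J v"] by linarith
    have "J (- J (A u v)) = A u v" by (simp add: J(2) linear_neg[OF J(1)])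
    then have "g (A u v) (A u v) = 0" using z[of "- J (A u v)"] by (simp add: a_def)
    with g(3)[OF ne] show False by simp
  qed
  then show ?thesis by (simp add: A_def fun_eq_iff)
qed

definition gauduchon_connection ::
  "(V6 \<Rightarrow> V6 \<Rightarrow> V6) \<Rightarrow> (V6 \<Rightarrow> V6) \<Rightarrow> (V6 \<Rightarrow> V6 \<Rightarrow> real) \<Rightarrow> real \<Rightarrow> V6 \<Rightarrow> V6 \<Rightarrow> V6" where
  "gauduchon_connection br J g \<tau> u v =
    ((1 + \<tau>) / 2) *\<^sub>R chern_connection br J g u v + ((1 - \<tau>) / 2) *\<^sub>R bismut_connection br J g u v"

definition curvature ::
  "(V6 \<Rightarrow> V6 \<Rightarrow> V6) \<Rightarrow> (V6 \<Rightarrow> V6 \<Rightarrow> V6) \<Rightarrow> V6 \<Rightarrow> V6 \<Rightarrow> V6 \<Rightarrow> V6" where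
  "curvature br D u v w = D u (D v w) - D v (D u w) - D (br u v) w"

definition orthonormal_frame :: "(V6 \<Rightarrow> V6 \<Rightarrow> real) \<Rightarrow> (nat \<Rightarrow> V6) \<Rightarrow> bool" where
  "orthonormal_frame g e \<longleftrightarrow> (\<forall>i<6. \<forall>j<6. g (e i) (e j) = (if i = j then 1 else 0))"

definition curv_form ::
  "(V6 \<Rightarrow> V6 \<Rightarrow> V6) \<Rightarrow> (V6 \<Rightarrow> V6 \<Rightarrow> V6) \<Rightarrow> (V6 \<Rightarrow> V6 \<Rightarrow> real) \<Rightarrow> (nat \<Rightarrow> V6) \<Rightarrow> nat \<Rightarrow> nat \<Rightarrow> form" where
  "curv_form br D g e i j vs = of_real (g (curvature br D (vs ! 0) (vs ! 1) (e j)) (e i))"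

definition tr_curv_wedge_curv ::
  "(V6 \<Rightarrow> V6 \<Rightarrow> V6) \<Rightarrow> (V6 \<Rightarrow> V6 \<Rightarrow> V6) \<Rightarrow> (V6 \<Rightarrow> V6 \<Rightarrow> real) \<Rightarrow> (nat \<Rightarrow> V6) \<Rightarrow> form" where
  "tr_curv_wedge_curv br D g e vs =
    (\<Sum>(i, j) \<in> {(i, j). i < j \<and> j < 6}.
      wedge 2 (curv_form br D g e i j) (curv_form br D g e i j) vs)"

section \<open>The Anomaly flow\<close>

text \<open>
  The equation at time \<open>t\<close>, as an equality of 4-forms.  The trace does not depend on the choice of
  the orthonormal frame \<open>e\<close>.
\<close>

definition anomaly_flow_at ::
  "(V6 \<Rightarrow> V6 \<Rightarrow> V6) \<Rightarrow> (V6 \<Rightarrow> V6) \<Rightarrow> (3 \<Rightarrow> V6 \<Rightarrow> complex) \<Rightarrow> real \<Rightarrow> real \<Rightarrow>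
    (real \<Rightarrow> complex ^ 3 ^ 3) \<Rightarrow> real \<Rightarrow> bool" where
  "anomaly_flow_at br J \<zeta> \<tau> \<alpha>' h t \<longleftrightarrow>
    (let \<omega> = (\<lambda>s. fundamental_form \<zeta> (h s));
         g = riem_metric J (\<omega> t);
         D = gauduchon_connection br J g \<tau>
     in \<exists>e. orthonormal_frame g e \<and>
        (\<forall>vs. length vs = 4 \<longrightarrow>
          ((\<lambda>s. of_real (Psi_norm (h s)) * wedge 2 (\<omega> s) (\<omega> s) vs) has_vector_derivative
            (\<i> * del br J 1 (delbar br J 1 (\<omega> t)) vs
              - of_real (\<alpha>' / 4) * tr_curv_wedge_curv br D g e vs)) (at t)))"

definition anomaly_flow_solution ::
  "(V6 \<Rightarrow> V6 \<Rightarrow> V6) \<Rightarrow> (V6 \<Rightarrow> V6) \<Rightarrow> (3 \<Rightarrow> V6 \<Rightarrow> complex) \<Rightarrow> real \<Rightarrow> real \<Rightarrow>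
    real set \<Rightarrow> (real \<Rightarrow> complex ^ 3 ^ 3) \<Rightarrow> bool" where
  "anomaly_flow_solution br J \<zeta> \<tau> \<alpha>' I h \<longleftrightarrow>
    open I \<and> is_interval I \<and> 0 \<in> I \<and>
    (\<forall>t\<in>I. positive_hermitian (h t) \<and> anomaly_flow_at br J \<zeta> \<tau> \<alpha>' h t)"

definition maximal_anomaly_flow_solution ::
  "(V6 \<Rightarrow> V6 \<Rightarrow> V6) \<Rightarrow> (V6 \<Rightarrow> V6) \<Rightarrow> (3 \<Rightarrow> V6 \<Rightarrow> complex) \<Rightarrow> real \<Rightarrow> real \<Rightarrow>
    real set \<Rightarrow> (real \<Rightarrow> complex ^ 3 ^ 3) \<Rightarrow> bool" where
  "maximal_anomaly_flow_solution br J \<zeta> \<tau> \<alpha>' I h \<longleftrightarrow>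
    anomaly_flow_solution br J \<zeta> \<tau> \<alpha>' I h \<and>
    (\<nexists>I' h'. I \<subset> I' \<and> anomaly_flow_solution br J \<zeta> \<tau> \<alpha>' I' h' \<and> (\<forall>t\<in>I. h' t = h t))"

definition immortal_solution ::
  "(V6 \<Rightarrow> V6 \<Rightarrow> V6) \<Rightarrow> (V6 \<Rightarrow> V6) \<Rightarrow> (3 \<Rightarrow> V6 \<Rightarrow> complex) \<Rightarrow> real \<Rightarrow> real \<Rightarrow>
    (real \<Rightarrow> complex ^ 3 ^ 3) \<Rightarrow> bool" where
  "immortal_solution br J \<zeta> \<tau> \<alpha>' h \<longleftrightarrow>
    (\<exists>\<epsilon>>0. maximal_anomaly_flow_solution br J \<zeta> \<tau> \<alpha>' {- \<epsilon><..} h)"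

definition ancient_solution ::
  "(V6 \<Rightarrow> V6 \<Rightarrow> V6) \<Rightarrow> (V6 \<Rightarrow> V6) \<Rightarrow> (3 \<Rightarrow> V6 \<Rightarrow> complex) \<Rightarrow> real \<Rightarrow> real \<Rightarrow>
    (real \<Rightarrow> complex ^ 3 ^ 3) \<Rightarrow> bool" where
  "ancient_solution br J \<zeta> \<tau> \<alpha>' h \<longleftrightarrow>
    (\<exists>\<epsilon>>0. maximal_anomaly_flow_solution br J \<zeta> \<tau> \<alpha>' {..<\<epsilon>} h)"

end

theory Submission
  imports Defs
begin

text \<open>
  The coframe identifies the Lie algebra with \<open>\<complex>\<^sup>3\<close>, and the structure equations turn the bracket
  into an explicit expression with values in the center \<open>\<zeta>\<^sup>1 = \<zeta>\<^sup>2 = 0\<close>.  For the metrics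
  \<open>h = diag(a, a, 1)\<close> only the coefficient of \<open>\<zeta>\<^sup>1 \<and> cnj \<zeta>\<^sup>1 \<and> \<zeta>\<^sup>2 \<and> cnj \<zeta>\<^sup>2\<close> in \<open>\<parallel>\<Psi>\<parallel>\<omega>\<^sup>2\<close> depends
  on \<open>a\<close>,
  and both \<open>i\<partial>\<partial>\<close>-bar \<open>\<omega>\<close> and the trace term are multiples of that 4-form.  So the flow becomes
  \<open>sqrt 8 a' = K - \<alpha>' F(\<tau>) / a\<^sup>2\<close> with \<open>K = \<rho>\<^sup>2 + \<lambda>\<^sup>2 - 2x\<close> and a polynomial \<open>F\<close> in \<open>\<tau>\<close> that vanishes at
  the Chern connection \<open>\<tau> = 1\<close> but is not identically zero when \<open>K \<noteq> 0\<close>.  Fixing \<open>\<tau>\<close> with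
  \<open>F(\<tau>) \<noteq> 0\<close>, the sign and size of \<open>\<alpha>'\<close> reduce the equation to \<open>f' = \<plusminus>1 + 1/f\<^sup>2\<close> on
  \<open>(0, \<infinity>)\<close>, up to time scaling and time reversal, with \<open>f \<longrightarrow> 0\<close> at \<open>0\<close>; this degeneration is
  also what makes the solutions maximal.
\<close>

section \<open>Wedge products of 2-forms\<close>

lemma sum_permutes_2:
  fixes f :: "nat \<Rightarrow> nat \<Rightarrow> complex"
  shows "(\<Sum>\<sigma> | \<sigma> permutes {..<2}. of_int (sign \<sigma>) * f (\<sigma> 0) (\<sigma> 1)) = f 0 1 - f 1 0"
proof -
  have eq: "{..<2::nat} = {0, 1}" by auto
  have "(0::nat) \<notin> {1}" by simp
  then show ?thesis
    unfolding eq
    by (subst sum_over_permutations_insert) (simp_all add: sign_swap_id sign_id transpose_def)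
qed

lemma sum_permutes_4:
  fixes f :: "nat \<Rightarrow> nat \<Rightarrow> nat \<Rightarrow> nat \<Rightarrow> complex"
  shows "(\<Sum>\<sigma> | \<sigma> permutes {..<4}. of_int (sign \<sigma>) * f (\<sigma> 0) (\<sigma> 1) (\<sigma> 2) (\<sigma> 3)) =
    f 0 1 2 3 - f 0 1 3 2 - f 0 2 1 3 + f 0 2 3 1 + f 0 3 1 2 - f 0 3 2 1
  - f 1 0 2 3 + f 1 0 3 2 + f 1 2 0 3 - f 1 2 3 0 - f 1 3 0 2 + f 1 3 2 0
  + f 2 0 1 3 - f 2 0 3 1 - f 2 1 0 3 + f 2 1 3 0 + f 2 3 0 1 - f 2 3 1 0
  - f 3 0 1 2 + f 3 0 2 1 + f 3 1 0 2 - f 3 1 2 0 - f 3 2 0 1 + f 3 2 1 0"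
proof -
  have eq: "{..<4::nat} = {0, 1, 2, 3}" by auto
  have *: "finite {1::nat,2,3}" "(0::nat) \<notin> {1,2,3}" "finite {2::nat,3}" "(1::nat) \<notin> {2,3}"
    "finite {3::nat}" "(2::nat) \<notin> {3}" by auto
  show ?thesis
    unfolding eq sum_over_permutations_insert[OF *(1,2)] sum_over_permutations_insert[OF *(3,4)]
      sum_over_permutations_insert[OF *(5,6)] permutes_sing
    by (simp add: sign_compose permutation_compose permutation_swap_id sign_swap_id sign_id
        transpose_def)
qed

lemma sum_pairs_6:
  fixes f :: "nat \<Rightarrow> nat \<Rightarrow> complex"
  shows "(\<Sum>(i, j)\<in>{(i, j). i < j \<and> j < 6}. f i j) =
    f 0 1 + f 0 2 + f 0 3 + f 0 4 + f 0 5 + f 1 2 + f 1 3 + f 1 4 + f 1 5 + f 2 3 + f 2 4 + f 2 5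
    + f 3 4 + f 3 5 + f 4 5"
proof -
  have "{(i, j). i < j \<and> j < (6::nat)} = Sigma {..<6} (\<lambda>i. {Suc i..<6})" by auto
  then have "(\<Sum>(i, j)\<in>{(i, j). i < j \<and> j < 6}. f i j) = (\<Sum>i<6. \<Sum>j=Suc i..<6. f i j)"
    by (simp add: sum.Sigma)
  also have "\<dots> = f 0 1 + f 0 2 + f 0 3 + f 0 4 + f 0 5 + f 1 2 + f 1 3 + f 1 4 + f 1 5 + f 2 3
      + f 2 4 + f 2 5
    + f 3 4 + f 3 5 + f 4 5"
    by (simp add: eval_nat_numeral)
  finally show ?thesis .
qed

lemma list_length_4: "length us = 4 \<Longrightarrow> \<exists>p q r t. us = [p, q, r, t]"
  by (auto simp: length_Suc_conv eval_nat_numeral)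

lemma wedge_1_1: "wedge 1 \<alpha> \<beta> [u, v] = \<alpha> [u] * \<beta> [v] - \<alpha> [v] * \<beta> [u]"
  using sum_permutes_2[of "\<lambda>i j. \<alpha> [[u, v] ! i] * \<beta> [[u, v] ! j]"]
  by (simp add: wedge_def mult.assoc numeral_2_eq_2 upt_rec)

lemma z_z_pair: "z_z \<zeta> i j [u, v] = \<zeta> i u * \<zeta> j v - \<zeta> i v * \<zeta> j u"
  by (simp add: z_z_def wedge_1_1[unfolded One_nat_def] one_form_def)

lemma z_zbar_pair: "z_zbar \<zeta> i j [u, v] = \<zeta> i u * cnj (\<zeta> j v) - \<zeta> i v * cnj (\<zeta> j u)"
  by (simp add: z_zbar_def wedge_1_1[unfolded One_nat_def] one_form_def)

text \<open>The six (2,2)-shuffles: for skew factors each stands for four permutations with equal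
  terms, which absorbs the denominator \<open>fact 2 * fact 2\<close> of
  \<open>wedge\<close>.\<close>

definition wedge22 :: "('a \<Rightarrow> 'a \<Rightarrow> complex) \<Rightarrow> ('a \<Rightarrow> 'a \<Rightarrow> complex) \<Rightarrow> 'a \<Rightarrow> 'a \<Rightarrow> 'a \<Rightarrow> 'a \<Rightarrow> complex" where
  "wedge22 \<alpha> \<beta> a b c d = \<alpha> a b * \<beta> c d - \<alpha> a c * \<beta> b d + \<alpha> a d * \<beta> b c
     + \<alpha> b c * \<beta> a d - \<alpha> b d * \<beta> a c + \<alpha> c d * \<beta> a b"

lemma wedge_2_2:
  assumes \<alpha>: "\<And>u v. \<alpha> [v, u] = - \<alpha> [u, v]" and \<beta>: "\<And>u v. \<beta> [v, u] = - \<beta> [u, v]"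
  shows "wedge 2 \<alpha> \<beta> [a, b, c, d] = wedge22 (\<lambda>u v. \<alpha> [u, v]) (\<lambda>u v. \<beta> [u, v]) a b c d"
proof -
  define f where "f i j k l = \<alpha> [[a,b,c,d] ! i, [a,b,c,d] ! j] * \<beta> [[a,b,c,d] ! k, [a,b,c,d] ! l]"
      for i j k l
  have "wedge 2 \<alpha> \<beta> [a, b, c, d] =
     (\<Sum>\<sigma> | \<sigma> permutes {..<4}. of_int (sign \<sigma>) * f (\<sigma> 0) (\<sigma> 1) (\<sigma> 2) (\<sigma> 3)) / 4"
    by (simp add: wedge_def f_def mult.assoc upt_rec eval_nat_numeral)
  also have "\<dots> = wedge22 (\<lambda>u v. \<alpha> [u, v]) (\<lambda>u v. \<beta> [u, v]) a b c d"
    unfolding sum_permutes_4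
    using \<alpha>[of a b] \<alpha>[of a c] \<alpha>[of a d] \<alpha>[of b c] \<alpha>[of b d] \<alpha>[of c d]
      \<beta>[of a b] \<beta>[of a c] \<beta>[of a d] \<beta>[of b c] \<beta>[of b d] \<beta>[of c d]
    by (simp add: f_def wedge22_def)
  finally show ?thesis .
qed

text \<open>\<open>cij\<close> multiplies \<zeta>^i \<and> cnj \<zeta>^j, while \<open>c20\<close>
  and \<open>c02\<close> belong to the bidegrees (2,0) and (0,2).\<close>

definition two_form ::
  "(3 \<Rightarrow> 'a \<Rightarrow> complex) \<Rightarrow> complex \<Rightarrow> complex \<Rightarrow> complex \<Rightarrow> complex \<Rightarrow> complex \<Rightarrow> complex \<Rightarrow> 'a \<Rightarrow> 'a \<Rightarrow>
      complex" where
  "two_form \<zeta> c11 c12 c21 c22 c20 c02 u v =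
     c11 * (\<zeta> 1 u * cnj (\<zeta> 1 v) - \<zeta> 1 v * cnj (\<zeta> 1 u))
   + c12 * (\<zeta> 1 u * cnj (\<zeta> 2 v) - \<zeta> 1 v * cnj (\<zeta> 2 u))
   + c21 * (\<zeta> 2 u * cnj (\<zeta> 1 v) - \<zeta> 2 v * cnj (\<zeta> 1 u))
   + c22 * (\<zeta> 2 u * cnj (\<zeta> 2 v) - \<zeta> 2 v * cnj (\<zeta> 2 u))
   + c20 * (\<zeta> 1 u * \<zeta> 2 v - \<zeta> 1 v * \<zeta> 2 u)
   + c02 * (cnj (\<zeta> 1 u) * cnj (\<zeta> 2 v) - cnj (\<zeta> 1 v) * cnj (\<zeta> 2 u))"

definition vol4 :: "(3 \<Rightarrow> 'a \<Rightarrow> complex) \<Rightarrow> 'a \<Rightarrow> 'a \<Rightarrow> 'a \<Rightarrow> 'a \<Rightarrow> complex" where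
  "vol4 \<zeta> = wedge22 (two_form \<zeta> 1 0 0 0 0 0) (two_form \<zeta> 0 0 0 1 0 0)"

text \<open>The 4-forms in \<zeta>^1, \<zeta>^2 and their conjugates form a line, so the wedge
  product is a pairing of coefficients; the minus signs come from reordering factors.\<close>

lemma wedge_two_form:
  "wedge22 (two_form \<zeta> c11 c12 c21 c22 c20 c02) (two_form \<zeta> d11 d12 d21 d22 d20 d02) p q r t =
   (c11 * d22 + c22 * d11 - c12 * d21 - c21 * d12 - c20 * d02 - c02 * d20) * vol4 \<zeta> p q r t"
  unfolding wedge22_def two_form_def vol4_def by algebra

section \<open>The trace of the squared curvature\<close>

lemma matrix_diff_mult:
  fixes A B C :: "'a::comm_ring_1 ^ 'n ^ 'n"
  shows "(A - B) ** C = A ** C - B ** C" and "C ** (A - B) = C ** A - C ** B"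
  by (simp_all add: matrix_matrix_mult_def vec_eq_iff sum_subtractf left_diff_distrib
      right_diff_distrib)

definition commut :: "'a::comm_ring_1 ^ 'n ^ 'n \<Rightarrow> 'a ^ 'n ^ 'n \<Rightarrow> 'a ^ 'n ^ 'n" where
  "commut X Y = X ** Y - Y ** X"

text \<open>A cyclic shift of four factors is an odd permutation and leaves the trace unchanged, so
  the terms cancel in pairs. This is tr(A \<and> A \<and> A \<and> A) = 0 for a matrix-valued 1-form
  A.\<close>

lemma trace_commut_alt:
  "trace (commut A B ** commut C D) - trace (commut A C ** commut B D)
     + trace (commut A D ** commut B C) = 0"
proof -
  have cyc: "trace (P ** Q ** R ** S) = trace (Q ** R ** S ** P)" for P Q R S :: "'a ^ 'n ^ 'n"
    by (subst trace_mul_sym) (simp add: matrix_mul_assoc trace_mul_sym[of P])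
  show ?thesis
    using cyc[of B A C D] cyc[of A C D B] cyc[of B A D C] cyc[of A D C B]
      cyc[of C A B D] cyc[of A B D C] cyc[of D A B C] cyc[of D A C B] cyc[of C A D B] cyc[of A D B C]
      cyc[of B C A D] cyc[of C B A D] cyc[of C D A B] cyc[of D C A B] cyc[of B D A C] cyc[of D B A C]
      cyc[of B C D A] cyc[of B D C A] cyc[of C B D A] cyc[of C D B A] cyc[of D B C A] cyc[of D C B A]
    by (simp add: commut_def matrix_diff_mult matrix_mul_assoc trace_sub)
qed

text \<open>
  The matrix of \<open>\<nabla>\<^sub>u\<close> in the coframe for \<open>(1 - s)\<close> times the Chern plus \<open>s\<close> times the Bismut connection
  of the metric \<open>diag(a, a, 1)\<close>, where \<open>b = 1/a\<close>, \<open>r = \<rho>\<close>, \<open>l = \<lambda>\<close> and \<open>z = x + iy\<close>.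
\<close>

definition conn_matrix ::
  "complex \<Rightarrow> complex \<Rightarrow> complex \<Rightarrow> complex \<Rightarrow> complex \<Rightarrow> (3 \<Rightarrow> 'a \<Rightarrow> complex) \<Rightarrow> 'a \<Rightarrow> complex ^ 3 ^ 3" where
  "conn_matrix s b r l z \<zeta> u = vector
    [vector [s * b * (cnj (\<zeta> 3 u) - \<zeta> 3 u), - s * b * l * \<zeta> 3 u,
        - b * ((1 - s) * (\<zeta> 1 u + l * \<zeta> 2 u) + s * r * cnj (\<zeta> 2 u))],
     vector [s * b * l * cnj (\<zeta> 3 u), s * b * (z * cnj (\<zeta> 3 u) - cnj z * \<zeta> 3 u),
        b * (s * r * cnj (\<zeta> 1 u) - (1 - s) * cnj z * \<zeta> 2 u)],
     vector [(1 - s) * (cnj (\<zeta> 1 u) + l * cnj (\<zeta> 2 u)) + s * r * \<zeta> 2 u,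
        (1 - s) * z * cnj (\<zeta> 2 u) - s * r * \<zeta> 1 u, 0]]"

text \<open>
  In a central direction, \<open>\<zeta>\<^sup>1 u = \<zeta>\<^sup>2 u = 0\<close>, the connection matrix is
  \<open>s b (cnj (\<zeta>\<^sup>3 u) M01 - \<zeta>\<^sup>3 u M10)\<close>.
\<close>

definition M10 :: "complex \<Rightarrow> complex \<Rightarrow> complex ^ 3 ^ 3" where
  "M10 l z = vector [vector [1, l, 0], vector [0, cnj z, 0], vector [0, 0, 0]]"

definition M01 :: "complex \<Rightarrow> complex \<Rightarrow> complex ^ 3 ^ 3" where
  "M01 l z = vector [vector [1, 0, 0], vector [l, z, 0], vector [0, 0, 0]]"

text \<open>No \<zeta>^3 survives: its part of the connection contributes multiples of
  \<open>trace (commut (M01 l z) (M10 l z) ** M10 l z)\<close>, zero by cyclicity, and the cross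
  terms with the remaining part are block off-diagonal, hence traceless against
  \<open>M10 l z\<close>.\<close>

lemma trace_commut_M10:
  "trace (commut (conn_matrix s b r l z \<zeta> u) (conn_matrix s b r l z \<zeta> v) ** M10 l z) =
    two_form \<zeta> (b * (s\<^sup>2 * r\<^sup>2 * cnj z - (1 - s)\<^sup>2)) (- b * (1 - s)\<^sup>2 * l)
      (- b * l * ((1 - s)\<^sup>2 * (1 + cnj z) + s\<^sup>2 * r\<^sup>2))
      (b * (s\<^sup>2 * r\<^sup>2 - (1 - s)\<^sup>2 * (l\<^sup>2 * (1 + cnj z) + z * (cnj z)\<^sup>2)))
      (- b * (1 - s) * s * r * (1 + (cnj z)\<^sup>2))
      (b * (1 - s) * s * r * (1 + l\<^sup>2 + z * cnj z)) u v"
  unfolding commut_def conn_matrix_def M10_def trace_def matrix_matrix_mult_def two_form_def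
  by (simp add: sum_3) algebra

lemma trace_commut_M01:
  "trace (commut (conn_matrix s b r l z \<zeta> u) (conn_matrix s b r l z \<zeta> v) ** M01 l z) =
    two_form \<zeta> (b * (s\<^sup>2 * r\<^sup>2 * z - (1 - s)\<^sup>2))
      (- b * l * ((1 - s)\<^sup>2 * (1 + z) + s\<^sup>2 * r\<^sup>2)) (- b * (1 - s)\<^sup>2 * l)
      (b * (s\<^sup>2 * r\<^sup>2 - (1 - s)\<^sup>2 * (l\<^sup>2 * (1 + z) + z\<^sup>2 * cnj z)))
      (- b * (1 - s) * s * r * (1 + l\<^sup>2 + z * cnj z))
      (b * (1 - s) * s * r * (1 + z\<^sup>2)) u v"
  unfolding commut_def conn_matrix_def M01_def trace_def matrix_matrix_mult_def two_form_def
  by (simp add: sum_3) algebra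

text \<open>For \<open>p\<close> the value of d\<zeta>^3 on two vectors and \<open>q\<close> its
  conjugate, this is the connection matrix along their bracket; the signs come from
  \<zeta>^3([u, v]) = - d\<zeta>^3(u, v).\<close>

definition bracket_matrix :: "complex \<Rightarrow> complex \<Rightarrow> complex \<Rightarrow> complex \<Rightarrow> complex \<Rightarrow> complex \<Rightarrow>
    complex ^ 3 ^ 3" where
  "bracket_matrix s b l z p q = (\<chi> i j. s * b * (p * M10 l z $ i $ j - q * M01 l z $ i $ j))"

lemma trace_mult_bracket_matrix:
  "trace (C ** bracket_matrix s b l z p q) =
      s * b * (p * trace (C ** M10 l z) - q * trace (C ** M01 l z))"
  "trace (bracket_matrix s b l z p q ** C) =
      s * b * (p * trace (C ** M10 l z) - q * trace (C ** M01 l z))"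
  by (simp_all add: bracket_matrix_def trace_def matrix_matrix_mult_def sum_3 algebra_simps)

lemma trace_bracket_matrix_sq:
  "trace (bracket_matrix s b l z p q ** bracket_matrix s b l z p' q') =
    s\<^sup>2 * b\<^sup>2 * (p * p' * (1 + (cnj z)\<^sup>2) - (p * q' + q * p') * (1 + l\<^sup>2 + z * cnj z) + q * q' *
        (1 + z\<^sup>2))"
  by (simp add: bracket_matrix_def M10_def M01_def trace_def matrix_matrix_mult_def sum_3
     algebra_simps power2_eq_square)

text \<open>
  The part quartic in the connection cancels by cyclicity of the trace; what remains are
  wedge products of 2-forms in \<open>\<zeta>\<^sup>1, \<zeta>\<^sup>2\<close> and their conjugates.
\<close>

lemma trace_curvature_alt:
  fixes \<zeta> :: "3 \<Rightarrow> 'a \<Rightarrow> complex" and s b r l z :: complex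
  defines "L \<equiv> conn_matrix s b r l z \<zeta>"
    and "\<psi> \<equiv> two_form \<zeta> 1 l 0 z r 0"
    and "\<psi>' \<equiv> two_form \<zeta> (- 1) 0 (- l) (- cnj z) 0 r"
  defines "R \<equiv> \<lambda>u v. commut (L u) (L v) - bracket_matrix s b l z (\<psi> u v) (\<psi>' u v)"
  shows "trace (R v0 v1 ** R v2 v3) - trace (R v0 v2 ** R v1 v3) + trace (R v0 v3 ** R v1 v2) =
    b\<^sup>2 * s * ((z + cnj z) * (1 + z * cnj z) * (1 - s + s\<^sup>2)
      - s * (1 + l\<^sup>2 + z * cnj z) * (r\<^sup>2 + l\<^sup>2 - (z + cnj z) - 4 * r\<^sup>2 * (1 - s))) * vol4 \<zeta> v0 v1 v2 v3"
proof -
  define m where "m u v = trace (commut (L u) (L v) ** M10 l z)" for u v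
  define m' where "m' u v = trace (commut (L u) (L v) ** M01 l z)" for u v
  have RR: "trace (R u v ** R u' v') = trace (commut (L u) (L v) ** commut (L u') (L v'))
     - s * b * (\<psi> u' v' * m u v - \<psi>' u' v' * m' u v) - s * b * (\<psi> u v * m u' v' - \<psi>' u v * m' u' v')
     + s\<^sup>2 * b\<^sup>2 * (\<psi> u v * \<psi> u' v' * (1 + (cnj z)\<^sup>2)
         - (\<psi> u v * \<psi>' u' v' + \<psi>' u v * \<psi> u' v') * (1 + l\<^sup>2 + z * cnj z) + \<psi>' u v * \<psi>' u' v' *
             (1 + z\<^sup>2))"
    for u v u' v'
    unfolding R_def m_def m'_def
    unfolding matrix_diff_mult trace_sub trace_bracket_matrix_sq
    unfolding trace_mult_bracket_matrix by simp
  \<comment> \<open>The mixed products over three pairings already form a full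
    \<open>wedge22\<close>, but those of \<psi> or \<psi>' with itself form only half of one;
    doubling removes the halves.\<close>
  have *: "2 * (trace (R v0 v1 ** R v2 v3) - trace (R v0 v2 ** R v1 v3) + trace (R v0 v3 ** R v1 v2)) =
    - 2 * s * b * (wedge22 m \<psi> v0 v1 v2 v3 - wedge22 m' \<psi>' v0 v1 v2 v3)
    + s\<^sup>2 * b\<^sup>2 * (wedge22 \<psi> \<psi> v0 v1 v2 v3 * (1 + (cnj z)\<^sup>2)
       - 2 * wedge22 \<psi> \<psi>' v0 v1 v2 v3 * (1 + l\<^sup>2 + z * cnj z) + wedge22 \<psi>' \<psi>' v0 v1 v2 v3 * (1 + z\<^sup>2))"
    using trace_commut_alt[of "L v0" "L v1" "L v2" "L v3"]
    unfolding RR wedge22_def by algebra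
  have m: "m = two_form \<zeta> (b * (s\<^sup>2 * r\<^sup>2 * cnj z - (1 - s)\<^sup>2)) (- b * (1 - s)\<^sup>2 * l)
      (- b * l * ((1 - s)\<^sup>2 * (1 + cnj z) + s\<^sup>2 * r\<^sup>2))
      (b * (s\<^sup>2 * r\<^sup>2 - (1 - s)\<^sup>2 * (l\<^sup>2 * (1 + cnj z) + z * (cnj z)\<^sup>2)))
      (- b * (1 - s) * s * r * (1 + (cnj z)\<^sup>2))
      (b * (1 - s) * s * r * (1 + l\<^sup>2 + z * cnj z))"
    by (intro ext) (simp only: m_def L_def trace_commut_M10)
  have m': "m' = two_form \<zeta> (b * (s\<^sup>2 * r\<^sup>2 * z - (1 - s)\<^sup>2))
      (- b * l * ((1 - s)\<^sup>2 * (1 + z) + s\<^sup>2 * r\<^sup>2)) (- b * (1 - s)\<^sup>2 * l)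
      (b * (s\<^sup>2 * r\<^sup>2 - (1 - s)\<^sup>2 * (l\<^sup>2 * (1 + z) + z\<^sup>2 * cnj z)))
      (- b * (1 - s) * s * r * (1 + l\<^sup>2 + z * cnj z))
      (b * (1 - s) * s * r * (1 + z\<^sup>2))"
    by (intro ext) (simp only: m'_def L_def trace_commut_M01)
  have "2 * (trace (R v0 v1 ** R v2 v3) - trace (R v0 v2 ** R v1 v3) + trace (R v0 v3 ** R v1 v2)) =
    2 * (b\<^sup>2 * s * ((z + cnj z) * (1 + z * cnj z) * (1 - s + s\<^sup>2)
      - s * (1 + l\<^sup>2 + z * cnj z) * (r\<^sup>2 + l\<^sup>2 - (z + cnj z) - 4 * r\<^sup>2 * (1 - s))) * vol4 \<zeta> v0 v1
          v2 v3)"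
    unfolding * m m' \<psi>_def \<psi>'_def wedge_two_form by algebra
  then show ?thesis by (simp only: mult_cancel_left) simp
qed

section \<open>The scalar equation\<close>

text \<open>Separation of variables: \<open>G\<close> is the primitive of
  \<open>1 / (sg + 1 / a\<^sup>2)\<close>, it increases from 0 to infinity on the domain
  \<open>P\<close>, and its inverse solves the equation for all positive times. \<open>P\<close>
  cuts the domain off at an equilibrium, if there is one.\<close>

lemma ode_inverse_function:
  fixes G :: "real \<Rightarrow> real" and sg :: real
  assumes down: "\<And>a b. P b \<Longrightarrow> 0 \<le> a \<Longrightarrow> a \<le> b \<Longrightarrow> P a"
    and up: "\<And>a. P a \<Longrightarrow> \<exists>b>a. P b"
    and sg: "\<And>a. 0 < a \<Longrightarrow> P a \<Longrightarrow> 0 < sg + 1 / a\<^sup>2"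
    and cont: "continuous_on {a. 0 \<le> a \<and> P a} G" and G0: "G 0 = 0"
    and deriv: "\<And>a. 0 < a \<Longrightarrow> P a \<Longrightarrow> (G has_real_derivative 1 / (sg + 1 / a\<^sup>2)) (at a)"
    and unb: "\<And>t. \<exists>a. 0 < a \<and> P a \<and> t < G a"
  shows "\<exists>f. (\<forall>t>0. 0 < f t \<and> (f has_real_derivative sg + 1 / (f t)\<^sup>2) (at t)) \<and> (f \<longlongrightarrow> 0) (at_right 0)"
proof -
  have mono: "G a < G b" if "0 \<le> a" "a < b" "P b" for a b
  proof (rule DERIV_pos_imp_increasing_open[OF \<open>a < b\<close>])
    fix u assume "a < u" "u < b"
    moreover from this have "P u" using down[of b u] that by simp
    ultimately show "\<exists>y. (G has_real_derivative y) (at u) \<and> 0 < y"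
      using deriv[of u] sg[of u] that by (intro exI[of _ "1 / (sg + 1 / u\<^sup>2)"]) auto
  next
    show "continuous_on {a..b} G"
      using cont by (rule continuous_on_subset) (use that down in auto)
  qed
  have inj: "a = b" if "G a = G b" "0 \<le> a" "P a" "0 \<le> b" "P b" for a b
    using that mono[of a b] mono[of b a] by (cases a b rule: linorder_cases) auto
  have surj: "\<exists>a. 0 < a \<and> P a \<and> G a = t" if "0 < t" for t
  proof -
    obtain b where b: "0 < b" "P b" "t < G b" using unb by blast
    have "\<exists>a. 0 \<le> a \<and> a \<le> b \<and> G a = t"
    proof (rule IVT')
      show "continuous_on {0..b} G" using cont by (rule continuous_on_subset) (use b down in auto)
    qed (use b G0 that in auto)
    then obtain a where a: "0 \<le> a" "a \<le> b" "G a = t" by blast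
    then have "a \<noteq> 0" "P a" using that G0 down b by auto
    with a show ?thesis by (intro exI[of _ a]) simp
  qed
  define f where "f t = (SOME a. 0 < a \<and> P a \<and> G a = t)" for t
  have f: "0 < f t" "P (f t)" "G (f t) = t" if "0 < t" for t
    using someI_ex[OF surj[OF that]] unfolding f_def by blast+
  have Gpos: "0 < G a" if "0 < a" "P a" for a
    using mono[of 0 a] that G0 by simp
  have fG: "f (G a) = a" if "0 < a" "P a" for a
    using f[OF Gpos[OF that]] inj[of "f (G a)" a] that by simp
  have fmono: "f s < f t" if "0 < s" "s < t" for s t
    using mono[of "f t" "f s"] f[of s] f[of t] that by (cases "f s" "f t" rule: linorder_cases) auto
  have deriv_f: "(f has_real_derivative sg + 1 / (f t)\<^sup>2) (at t)" if "0 < t" for t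
  proof -
    have "isCont f t"
    proof -
      note Pf = f(2)[OF that]
      \<comment> \<open>Openness of \<open>P\<close> leaves room above \<open>f t\<close>, so
        \<open>f\<close> inverts \<open>G\<close> on a whole neighbourhood of
        \<open>f t\<close>.\<close>
      obtain b where b: "f t < b" "P b" using up[OF Pf] by blast
      define d where "d = min (f t) (b - f t) / 2"
      have d: "0 < d" "d < f t" "f t + d < b" using f(1)[OF that] b
          by (auto simp: d_def min_def field_simps)
      have "isCont f (G (f t))"
      proof (rule isCont_inverse_function[where f = G and x = "f t", OF d(1)])
        fix z assume "\<bar>z - f t\<bar> \<le> d"
        then have z: "0 < z" "z \<le> b" using d by auto
        then have Pz: "P z" using down[OF b(2)] by simp
        show "f (G z) = z" using fG z Pz by blast
        show "isCont G z" using deriv[OF z(1) Pz] DERIV_isCont by blast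
      qed
      then show ?thesis using f(3)[OF that] by simp
    qed
    then have "(f has_real_derivative inverse (1 / (sg + 1 / (f t)\<^sup>2))) (at t)"
    proof (rule DERIV_inverse_function[where f = G and a = 0 and b = "t + 1", rotated -1])
      show "(G has_real_derivative 1 / (sg + 1 / (f t)\<^sup>2)) (at (f t))"
        using deriv f that by blast
      show "1 / (sg + 1 / (f t)\<^sup>2) \<noteq> 0" using sg[of "f t"] f that by simp
    qed (use f that in auto)
    then show ?thesis by simp
  qed
  have "(f \<longlongrightarrow> 0) (at_right 0)"
  proof (rule tendstoI)
    fix e :: real assume "0 < e"
    obtain c where c: "0 < c" "P c" using unb by blast
    define d where "d = min e c / 2"
    have d: "0 < d" "d < c" "d < e" using \<open>0 < e\<close> c by (auto simp: d_def min_def)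
    then have Pd: "P d" using down[OF c(2)] by simp
    \<comment> \<open>Monotonicity bounds \<open>f t\<close> by \<open>f (G d) = d\<close>.\<close>
    have "dist (f t) 0 < e" if "0 < t" "t < G d" for t
      using fmono[OF that] fG[OF d(1) Pd] d f(1)[OF that(1)] by simp
    then show "\<forall>\<^sub>F t in at_right 0. dist (f t) 0 < e"
      unfolding eventually_at_right_field using Gpos[OF d(1) Pd] by blast
  qed
  then show ?thesis using f(1) deriv_f by blast
qed

text \<open>Here the integrand is 1 - 1/(1 + a^2), with primitive a - arctan a on the whole
  half-line.\<close>

lemma ode_solution_plus:
  "\<exists>f :: real \<Rightarrow> real. (\<forall>t>0. 0 < f t \<and> (f has_real_derivative 1 + 1 / (f t)\<^sup>2) (at t))
      \<and> (f \<longlongrightarrow> 0) (at_right 0)"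
proof (rule ode_inverse_function[where P = "\<lambda>_. True" and G = "\<lambda>a. a - arctan a"])
  show "\<exists>b>a. True" for a :: real by (intro exI[of _ "a + 1"]) simp
  show "0 < 1 + 1 / a\<^sup>2" if "0 < a" for a :: real using that by (simp add: add_pos_pos)
  show "continuous_on {a::real. 0 \<le> a \<and> True} (\<lambda>a. a - arctan a)"
    by (intro continuous_intros)
  show "((\<lambda>a. a - arctan a) has_real_derivative 1 / (1 + 1 / a\<^sup>2)) (at a)" if "0 < a" for a :: real
  proof -
    have "1 + a\<^sup>2 > 0" by (simp add: add_pos_nonneg)
    then have "1 + a\<^sup>2 \<noteq> 0" "a \<noteq> 0" using that by auto
    then have "1 - inverse (1 + a\<^sup>2) = 1 / (1 + 1 / a\<^sup>2)"
        by (simp add: field_simps flip: add_divide_distrib)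
    moreover have "((\<lambda>a. a - arctan a) has_real_derivative 1 - inverse (1 + a\<^sup>2)) (at a)"
      by (intro DERIV_diff DERIV_arctan DERIV_ident)
    ultimately show ?thesis by simp
  qed
  show "\<exists>a. 0 < a \<and> True \<and> t < a - arctan a" for t :: real
    \<comment> \<open>The subtracted arctan is below pi/2 < 2.\<close>
    using arctan_ubound[of "\<bar>t\<bar> + 2"] pi_less_4 by (intro exI[of _ "\<bar>t\<bar> + 2"]) auto
qed auto

text \<open>The integrand is 1/(1 - a^2) - 1, with primitive artanh a - a; it blows up at the
  equilibrium a = 1, which the solution therefore never reaches.\<close>

lemma ode_solution_minus:
  "\<exists>f :: real \<Rightarrow> real. (\<forall>t>0. 0 < f t \<and> (f has_real_derivative - 1 + 1 / (f t)\<^sup>2) (at t))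
      \<and> (f \<longlongrightarrow> 0) (at_right 0)"
proof (rule ode_inverse_function[where P = "\<lambda>a. a < 1" and G = "\<lambda>a. artanh a - a"])
  show "\<exists>b>a. b < 1" if "a < 1" for a :: real using dense[OF that] .
  have sq: "0 < a\<^sup>2 \<and> a\<^sup>2 < 1" if "0 < a" "a < 1" for a :: real
    using that by (simp add: power_less_one_iff)
  show "0 < - 1 + 1 / a\<^sup>2" if "0 < a" "a < 1" for a :: real
    using sq[OF that] by simp
  show "continuous_on {a::real. 0 \<le> a \<and> a < 1} (\<lambda>a. artanh a - a)"
    by (intro continuous_intros) auto
  show "((\<lambda>a. artanh a - a) has_real_derivative 1 / (- 1 + 1 / a\<^sup>2)) (at a)" if "0 < a" "a < 1"
      for a :: real
  proof -
    have "1 / (1 - a\<^sup>2) - 1 = 1 / (- 1 + 1 / a\<^sup>2)" using sq[OF that] by (simp add: field_simps)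
    moreover have "((\<lambda>a. artanh a - a) has_real_derivative 1 / (1 - a\<^sup>2) - 1) (at a)"
      by (intro DERIV_diff artanh_real_has_field_derivative DERIV_ident) (use that in auto)
    ultimately show ?thesis by simp
  qed
  show "\<exists>a. 0 < a \<and> a < 1 \<and> t < artanh a - a" for t :: real
  proof -
    \<comment> \<open>At the witness tanh(|t| + 1) the artanh is |t| + 1, and the subtracted term is
      below 1.\<close>
    have "artanh (tanh (\<bar>t\<bar> + 1)) - tanh (\<bar>t\<bar> + 1) > t" using tanh_real_lt_1[of "\<bar>t\<bar> + 1"]
      by (simp add: artanh_tanh_real)
    moreover have "0 < tanh (\<bar>t\<bar> + 1)" by simp
    ultimately show ?thesis using tanh_real_lt_1 by blast
  qed
qed auto

section \<open>Exterior derivative and bidegree\<close>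

lemma ext_d_2: "ext_d br \<alpha> [u, v] = - \<alpha> [br u v]"
proof -
  have eq: "{(i, j). i < j \<and> j < length [u, v]} = {(0, 1)}" by auto
  show ?thesis unfolding ext_d_def eq by (simp add: nths_Cons)
qed

lemma ext_d_3: "ext_d br \<alpha> [u, v, w] = - \<alpha> [br u v, w] + \<alpha> [br u w, v] - \<alpha> [br v w, u]"
proof -
  have eq: "{(i, j). i < j \<and> j < length [u, v, w]} = {(0, 1), (0, 2), (1, 2)}" by auto
  show ?thesis unfolding ext_d_def eq by (simp add: nths_Cons)
qed

lemma ext_d_4: "ext_d br \<alpha> [u, v, w, t] = - \<alpha> [br u v, w, t] + \<alpha> [br u w, v, t] - \<alpha> [br u t, v, w]
    - \<alpha> [br v w, u, t] + \<alpha> [br v t, u, w] - \<alpha> [br w t, u, v]"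
proof -
  have eq: "{(i, j). i < j \<and> j < length [u, v, w, t]}
      = {(0, 1), (0, 2), (0, 3), (1, 2), (1, 3), (2, 3)}" by auto
  show ?thesis unfolding ext_d_def eq by (simp add: nths_Cons numeral_2_eq_2 numeral_3_eq_3)
qed

text \<open>The restriction on the length matters because the formulas for the differentials below
  hold only on lists of the right length.\<close>

lemma bideg_part_cong:
  assumes "\<And>us. length us = length vs \<Longrightarrow> \<alpha> us = \<beta> us"
  shows "bideg_part J p \<alpha> vs = bideg_part J p \<beta> vs"
  using assms
proof (induction vs arbitrary: p \<alpha> \<beta>)
  case Nil
  then show ?case by (cases p) auto
next
  case (Cons v vs)
  have "insert10 J v \<alpha> us = insert10 J v \<beta> us" "insert01 J v \<alpha> us = insert01 J v \<beta> us"
    if "length us = length vs" for us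
    using Cons.prems[of "_ # us"] that by (simp_all add: insert10_def insert01_def)
  then show ?case
    using Cons.IH[of "insert10 J v \<alpha>" "insert10 J v \<beta>"] Cons.IH[of "insert01 J v \<alpha>" "insert01 J v \<beta>"]
    by (cases p) auto
qed

lemma bideg_part_add:
  "bideg_part J p (\<lambda>us. \<alpha> us + \<beta> us) vs = bideg_part J p \<alpha> vs + bideg_part J p \<beta> vs"
proof (induction vs arbitrary: p \<alpha> \<beta>)
  case Nil
  then show ?case by (cases p) auto
next
  case (Cons v vs)
  have "insert10 J v (\<lambda>us. \<alpha> us + \<beta> us) = (\<lambda>us. insert10 J v \<alpha> us + insert10 J v \<beta> us)"
    "insert01 J v (\<lambda>us. \<alpha> us + \<beta> us) = (\<lambda>us. insert01 J v \<alpha> us + insert01 J v \<beta> us)"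
    by (auto simp: insert10_def insert01_def algebra_simps add_divide_distrib diff_divide_distrib)
  then show ?case by (cases p) (simp_all add: Cons.IH)
qed

lemma bideg_part_cmult: "bideg_part J p (\<lambda>us. c * \<alpha> us) vs = c * bideg_part J p \<alpha> vs"
proof (induction vs arbitrary: p \<alpha>)
  case Nil
  then show ?case by (cases p) auto
next
  case (Cons v vs)
  have "insert10 J v (\<lambda>us. c * \<alpha> us) = (\<lambda>us. c * insert10 J v \<alpha> us)"
    "insert01 J v (\<lambda>us. c * \<alpha> us) = (\<lambda>us. c * insert01 J v \<alpha> us)"
    by (auto simp: insert10_def insert01_def algebra_simps)
  then show ?case by (cases p) (simp_all add: Cons.IH algebra_simps)
qed

lemma bideg_part_sum:
  "finite A \<Longrightarrow> bideg_part J p (\<lambda>us. \<Sum>i\<in>A. c i * \<alpha> i us) vs = (\<Sum>i\<in>A. c i * bideg_part J p (\<alpha> i) vs)"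
proof (induction A rule: finite_induct)
  case empty
  then show ?case using bideg_part_cmult[of J p 0] by simp
qed (simp add: bideg_part_add bideg_part_cmult)

text \<open>
  The wedge product of a list of 1-forms, by Laplace expansion in the first argument; the
  boolean tags the forms of type \<open>(1,0)\<close>.
\<close>

fun alt_form :: "(bool \<times> (V6 \<Rightarrow> complex)) list \<Rightarrow> form" where
  "alt_form L [] = (if L = [] then 1 else 0)"
| "alt_form L (v # vs) =
    (\<Sum>i<length L. (- 1) ^ i * snd (L ! i) v * alt_form (take i L @ drop (Suc i) L) vs)"

text \<open>A wedge product of forms of pure type has pure type: in the Laplace expansion, inserting
  a (1,0)-part keeps exactly the terms whose removed factor is of type (1,0), and inserting a
  (0,1)-part keeps the others.\<close>

lemma bideg_part_alt_form:
  assumes "\<And>b f v. (b, f) \<in> set L \<Longrightarrow> f (J v) = (if b then \<i> else - \<i>) * f v"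
  shows "bideg_part J p (alt_form L) vs = (if length (filter fst L) = p then alt_form L vs else 0)"
  using assms
proof (induction vs arbitrary: p L)
  case Nil
  then show ?case by (cases p; cases L) (auto)
next
  case (Cons v vs)
  define R where "R i = take i L @ drop (Suc i) L" for i
  define c where "c i = (- 1) ^ i * snd (L ! i) v" for i
  have J: "snd (L ! i) (J v) = (if fst (L ! i) then \<i> else - \<i>) * snd (L ! i) v" if "i < length L" for i
    using Cons.prems[of "fst (L ! i)" "snd (L ! i)" v] that by simp
  have set_R: "set (R i) \<subseteq> set L" for i
    using set_take_subset[of i L] set_drop_subset[of "Suc i" L] by (auto simp: R_def)
  have count: "length (filter fst L) = length (filter fst (R i)) + (if fst (L ! i) then 1 else 0)"
    if "i < length L" for i
    by (subst (1) id_take_nth_drop[OF that]) (simp add: R_def)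
  have IH: "bideg_part J q (alt_form (R i)) vs
      = (if length (filter fst (R i)) = q then alt_form (R i) vs else 0)" for i q
    using Cons.IH[of "R i" q] Cons.prems set_R by blast
  have alt: "alt_form L (w # us) = (\<Sum>i<length L. (- 1) ^ i * snd (L ! i) w * alt_form (R i) us)"
      for w us
    by (simp add: R_def)
  have 10: "insert10 J v (alt_form L) =
      (\<lambda>us. \<Sum>i<length L. (if fst (L ! i) then c i else 0) * alt_form (R i) us)"
  proof
    fix us
    have "insert10 J v (alt_form L) us = (\<Sum>i<length L. ((- 1) ^ i * snd (L ! i) v * alt_form (R i) us
        - \<i> * ((- 1) ^ i * snd (L ! i) (J v) * alt_form (R i) us)) / 2)"
      by (simp only: insert10_def alt sum_subtractf sum_distrib_left sum_divide_distrib[symmetric])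
    also have "\<dots> = (\<Sum>i<length L. (if fst (L ! i) then c i else 0) * alt_form (R i) us)"
      by (rule sum.cong) (auto simp: J c_def algebra_simps)
    finally show "insert10 J v (alt_form L) us =
        (\<Sum>i<length L. (if fst (L ! i) then c i else 0) * alt_form (R i) us)" .
  qed
  have 01: "insert01 J v (alt_form L) =
      (\<lambda>us. \<Sum>i<length L. (if fst (L ! i) then 0 else c i) * alt_form (R i) us)"
  proof
    fix us
    have "insert01 J v (alt_form L) us = (\<Sum>i<length L. ((- 1) ^ i * snd (L ! i) v * alt_form (R i) us
        + \<i> * ((- 1) ^ i * snd (L ! i) (J v) * alt_form (R i) us)) / 2)"
      by (simp only: insert01_def alt sum.distrib sum_distrib_left sum_divide_distrib[symmetric])
    also have "\<dots> = (\<Sum>i<length L. (if fst (L ! i) then 0 else c i) * alt_form (R i) us)"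
      by (rule sum.cong) (auto simp: J c_def algebra_simps)
    finally show "insert01 J v (alt_form L) us =
        (\<Sum>i<length L. (if fst (L ! i) then 0 else c i) * alt_form (R i) us)" .
  qed
  have alt_c: "alt_form L (v # vs) = (\<Sum>i<length L. c i * alt_form (R i) vs)"
    by (simp only: c_def alt)
  show ?case
  proof (cases p)
    case 0
    have "bideg_part J p (alt_form L) (v # vs) = (\<Sum>i<length L. (if fst (L ! i) then 0 else c i)
       * (if length (filter fst (R i)) = 0 then alt_form (R i) vs else 0))"
      by (simp only: 0 bideg_part.simps 01 bideg_part_sum[OF finite_lessThan] IH)
    also have "\<dots> = (\<Sum>i<length L. if length (filter fst L) = p then c i * alt_form (R i) vs else 0)"
      by (rule sum.cong) (use count 0 in auto)
    finally show ?thesis unfolding alt_c by simp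
  next
    case (Suc q)
    have "bideg_part J p (alt_form L) (v # vs) = (\<Sum>i<length L. (if fst (L ! i) then c i else 0)
       * (if length (filter fst (R i)) = q then alt_form (R i) vs else 0)
       + (if fst (L ! i) then 0 else c i) *
           (if length (filter fst (R i)) = Suc q then alt_form (R i) vs else 0))"
      by (simp only: Suc bideg_part.simps 01 10 bideg_part_sum[OF finite_lessThan] IH sum.distrib)
    also have "\<dots> = (\<Sum>i<length L. if length (filter fst L) = p then c i * alt_form (R i) vs else 0)"
      by (rule sum.cong) (use count Suc in auto)
    finally show ?thesis unfolding alt_c by simp
  qed
qed

lemma alt_form_2: "alt_form [x, y] [u, v] = snd x u * snd y v - snd y u * snd x v"
  by simp

lemma alt_form_3: "alt_form [x, y, z] [u, v, w] =
    snd x u * alt_form [y, z] [v, w] - snd y u * alt_form [x, z] [v, w] + snd z u * alt_form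
        [x, y] [v, w]"
  by (subst alt_form.simps) (simp del: alt_form.simps)

lemma alt_form_4: "alt_form [x, y, z, r] [u, v, w, t] =
    snd x u * alt_form [y, z, r] [v, w, t] - snd y u * alt_form [x, z, r] [v, w, t]
    + snd z u * alt_form [x, y, r] [v, w, t] - snd r u * alt_form [x, y, z] [v, w, t]"
  by (subst alt_form.simps) (simp del: alt_form.simps)

lemma vol4_alt_form:
  "vol4 \<zeta> a b c d = alt_form [(True, \<zeta> 1), (False, \<lambda>v. cnj (\<zeta> 1 v)), (True, \<zeta> 2),
      (False, \<lambda>v. cnj (\<zeta> 2 v))] [a, b, c, d]"
  unfolding alt_form_4 alt_form_3 alt_form_2 vol4_def wedge22_def two_form_def snd_conv by algebra

section \<open>Hermitian geometry in the coframe\<close>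

text \<open>The six Lie algebras are treated at once, since the structure equations determine the
  bracket.\<close>

locale nilpotent_coframe =
  fixes br :: "V6 \<Rightarrow> V6 \<Rightarrow> V6" and J :: "V6 \<Rightarrow> V6" and \<zeta> :: "3 \<Rightarrow> V6 \<Rightarrow> complex"
    and \<rho> lam x y :: real
  assumes complex_structure: "complex_structure br J"
    and coframe: "coframe10 J \<zeta>"
    and structure_eqs: "structure_equations br \<zeta> \<rho> lam x y"
begin

abbreviation z :: complex where "z \<equiv> Complex x y"

lemma linear_J: "linear J" and J_J: "J (J v) = - v"
  using complex_structure by (auto simp: complex_structure_def)

lemma linear_\<zeta>: "linear (\<zeta> j)" and \<zeta>_J [simp]: "\<zeta> j (J v) = \<i> * \<zeta> j v"
  using coframe by (auto simp: coframe10_def)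

lemma \<zeta>_linear [simp]:
  "\<zeta> j (u + v) = \<zeta> j u + \<zeta> j v" "\<zeta> j (u - v) = \<zeta> j u - \<zeta> j v" "\<zeta> j (- v) = - \<zeta> j v"
  "\<zeta> j (c *\<^sub>R v) = of_real c * \<zeta> j v" "\<zeta> j 0 = 0"
  by (simp_all only: linear_add[OF linear_\<zeta>] linear_diff[OF linear_\<zeta>] linear_neg[OF linear_\<zeta>]
      linear_cmul[OF linear_\<zeta>] linear_0[OF linear_\<zeta>])
    (simp add: scaleR_conv_of_real)

text \<open>A vector orthogonal to the range yields a complex combination of the \<zeta>^j with
  vanishing real part; compatibility with \<open>J\<close> kills the imaginary part too,
  contradicting independence. So the map is onto, and both sides have real dimension 6.\<close>

lemma bij_coframe: "bij (\<lambda>v. \<chi> j. \<zeta> j v)"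
proof -
  define Z :: "V6 \<Rightarrow> complex ^ 3" where "Z = (\<lambda>v. \<chi> j. \<zeta> j v)"
  have lin: "linear Z"
    by (intro linearI) (simp_all add: Z_def vec_eq_iff, simp add: scaleR_conv_of_real)
  have "span (range Z) = UNIV"
  proof (rule ccontr)
    assume "span (range Z) \<noteq> UNIV"
    then have "dim (range Z) < DIM(complex ^ 3)"
      using dim_eq_full[of "range Z"] dim_subset_UNIV[of "range Z"] by linarith
    then obtain a where a: "a \<noteq> 0" "\<And>w. w \<in> span (range Z) \<Longrightarrow> orthogonal a w"
      using orthogonal_to_subspace_exists by blast
    define f where "f v = (\<Sum>j\<in>UNIV. cnj (a $ j) * \<zeta> j v)" for v
    have re: "Re (f v) = 0" for v
    proof -
      have "a \<bullet> Z v = 0" using a(2)[of "Z v"] by (simp add: orthogonal_def span_base)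
      then show ?thesis by (simp add: f_def Z_def inner_vec_def inner_complex_def)
    qed
    have "f v = 0" for v
    proof -
      have "f (J v) = \<i> * f v" by (simp add: f_def sum_distrib_left algebra_simps)
      then have "Im (f v) = - Re (f (J v))" by simp
      then show ?thesis using re by (simp add: complex_eq_iff)
    qed
    then have "\<forall>v. (\<Sum>j\<in>UNIV. cnj (a $ j) * \<zeta> j v) = 0" unfolding f_def by blast
    then have "\<forall>j. cnj (a $ j) = 0"
      using coframe[unfolded coframe10_def, THEN conjunct2, THEN spec, of "\<lambda>j. cnj (a $ j)"] by blast
    with a(1) show False by (simp add: vec_eq_iff)
  qed
  moreover have "span (range Z) = range Z"
    using lin by (metis linear_span_image span_UNIV)
  ultimately have "surj Z" by simp
  moreover have "inj Z"
    by (rule linear_surjective_imp_injective[OF lin \<open>surj Z\<close>]) simp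
  ultimately show ?thesis unfolding Z_def[symmetric] bij_def by simp
qed

lemma coframe_eqI: "u = v" if "\<And>j. \<zeta> j u = \<zeta> j v"
  using bij_is_inj[OF bij_coframe] that by (auto simp: inj_def vec_eq_iff)

definition vec_of :: "complex \<Rightarrow> complex \<Rightarrow> complex \<Rightarrow> V6" where
  "vec_of a b c = inv (\<lambda>v. \<chi> j. \<zeta> j v) (vector [a, b, c] :: complex ^ 3)"

lemma \<zeta>_vec_of [simp]: "\<zeta> 1 (vec_of a b c) = a" "\<zeta> 2 (vec_of a b c) = b" "\<zeta> 3 (vec_of a b c) = c"
proof -
  have "(\<chi> j. \<zeta> j (vec_of a b c)) = (vector [a, b, c] :: complex ^ 3)"
    unfolding vec_of_def by (rule surj_f_inv_f[OF bij_is_surj[OF bij_coframe]])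
  then have "\<zeta> j (vec_of a b c) = (vector [a, b, c] :: complex ^ 3) $ j" for j
    by (metis vec_lambda_beta)
  then show "\<zeta> 1 (vec_of a b c) = a" "\<zeta> 2 (vec_of a b c) = b" "\<zeta> 3 (vec_of a b c) = c"
    by (simp_all add: vector_3)
qed

abbreviation \<psi> :: "V6 \<Rightarrow> V6 \<Rightarrow> complex" where
  "\<psi> \<equiv> two_form \<zeta> 1 (of_real lam) 0 z (of_real \<rho>) 0"

lemma \<zeta>_br [simp]: "\<zeta> 1 (br u v) = 0" "\<zeta> 2 (br u v) = 0" "\<zeta> 3 (br u v) = - \<psi> u v"
proof -
  have "- \<zeta> 1 (br u v) = 0" "- \<zeta> 2 (br u v) = 0" "- \<zeta> 3 (br u v) = \<psi> u v"
    using structure_eqs unfolding structure_equations_def ext_d_2 z_z_pair z_zbar_pair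
    by (auto simp: one_form_def two_form_def)
  then show "\<zeta> 1 (br u v) = 0" "\<zeta> 2 (br u v) = 0" "\<zeta> 3 (br u v) = - \<psi> u v"
      by (simp, simp, metis minus_minus)
qed

section \<open>The metrics diag(a, a, 1)\<close>

definition metric_matrix :: "real \<Rightarrow> complex ^ 3 ^ 3" where
  "metric_matrix a = vector [vector [of_real a, 0, 0], vector [0, of_real a, 0], vector [0, 0, 1]]"

definition omega :: "real \<Rightarrow> form" where
  "omega a = fundamental_form \<zeta> (metric_matrix a)"

lemma omega_pair: "omega a [u, v] = \<i> / 2 * (of_real a * (\<zeta> 1 u * cnj (\<zeta> 1 v) - \<zeta> 1 v * cnj (\<zeta> 1 u)
    + \<zeta> 2 u * cnj (\<zeta> 2 v) - \<zeta> 2 v * cnj (\<zeta> 2 u)) + \<zeta> 3 u * cnj (\<zeta> 3 v) - \<zeta> 3 v * cnj (\<zeta> 3 u))"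
  by (simp add: omega_def fundamental_form_def metric_matrix_def z_zbar_pair sum_3 vector_3
      algebra_simps)

definition metric :: "real \<Rightarrow> V6 \<Rightarrow> V6 \<Rightarrow> real" where
  "metric a u v = Re (of_real a * (\<zeta> 1 u * cnj (\<zeta> 1 v) + \<zeta> 2 u * cnj (\<zeta> 2 v)) + \<zeta> 3 u * cnj (\<zeta> 3 v))"

lemma riem_metric_omega: "riem_metric J (omega a) = metric a"
  by (intro ext) (simp add: riem_metric_def omega_pair metric_def algebra_simps)

lemma metric_sym: "metric a u v = metric a v u"
  by (simp add: metric_def algebra_simps)

lemma metric_J: "metric a (J u) (J v) = metric a u v"
  by (simp add: metric_def algebra_simps)

lemma bilinear_metric: "bilinear (metric a)"
  unfolding bilinear_def by (intro conjI allI linearI) (simp_all add: metric_def algebra_simps)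

lemma metric_pos:
  assumes "0 < a" "v \<noteq> 0"
  shows "0 < metric a v v"
proof -
  have eq: "metric a v v = a * ((cmod (\<zeta> 1 v))\<^sup>2 + (cmod (\<zeta> 2 v))\<^sup>2) + (cmod (\<zeta> 3 v))\<^sup>2"
    by (simp add: metric_def cmod_power2, simp add: algebra_simps power2_eq_square)
  have "\<exists>j. \<zeta> j v \<noteq> 0"
    using coframe_eqI[of v 0] assms(2) by auto
  then have "\<zeta> 1 v \<noteq> 0 \<or> \<zeta> 2 v \<noteq> 0 \<or> \<zeta> 3 v \<noteq> 0" by (metis exhaust_3)
  then have "0 < (cmod (\<zeta> 1 v))\<^sup>2 + (cmod (\<zeta> 2 v))\<^sup>2 \<or> 0 < (cmod (\<zeta> 3 v))\<^sup>2"
    by (auto simp: sum_power2_gt_zero_iff)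
  then show ?thesis
    unfolding eq using assms(1) by (auto intro: add_pos_nonneg add_nonneg_pos)
qed

section \<open>Their Gauduchon connections\<close>

definition conn :: "real \<Rightarrow> real \<Rightarrow> V6 \<Rightarrow> complex ^ 3 ^ 3" where
  "conn s a = conn_matrix (of_real s) (of_real (1 / a)) (of_real \<rho>) (of_real lam) z \<zeta>"

text \<open>The candidate for the Gauduchon connection, built from coframe coordinates:
  \<open>s = 0\<close> will be the Chern and \<open>s = 1\<close> the Bismut connection.\<close>

definition nabla :: "real \<Rightarrow> real \<Rightarrow> V6 \<Rightarrow> V6 \<Rightarrow> V6" where
  "nabla s a u v = (let w = conn s a u *v (\<chi> j. \<zeta> j v) in vec_of (w $ 1) (w $ 2) (w $ 3))"

lemma \<zeta>_nabla: "\<zeta> j (nabla s a u v) = (\<Sum>k\<in>UNIV. conn s a u $ j $ k * \<zeta> k v)"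
  using exhaust_3[of j] by (auto simp: nabla_def matrix_vector_mult_def Let_def)

lemma \<zeta>_nabla_3:
  "\<zeta> 1 (nabla s a u v) =
      of_real (1 / a) * (of_real s * ((cnj (\<zeta> 3 u) - \<zeta> 3 u) * \<zeta> 1 v - of_real lam * \<zeta> 3 u * \<zeta> 2 v)
     - ((1 - of_real s) * (\<zeta> 1 u + of_real lam * \<zeta> 2 u) + of_real s * of_real \<rho> * cnj (\<zeta> 2 u)) * \<zeta> 3 v)"
  "\<zeta> 2 (nabla s a u v) =
      of_real (1 / a) * (of_real s *
      (of_real lam * cnj (\<zeta> 3 u) * \<zeta> 1 v + (z * cnj (\<zeta> 3 u) - cnj z * \<zeta> 3 u) * \<zeta> 2 v)
     + (of_real s * of_real \<rho> * cnj (\<zeta> 1 u) - (1 - of_real s) * cnj z * \<zeta> 2 u) * \<zeta> 3 v)"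
  "\<zeta> 3 (nabla s a u v) =
      ((1 - of_real s) * (cnj (\<zeta> 1 u) + of_real lam * cnj (\<zeta> 2 u)) + of_real s * of_real \<rho> * \<zeta> 2
      u) * \<zeta> 1 v
     + ((1 - of_real s) * z * cnj (\<zeta> 2 u) - of_real s * of_real \<rho> * \<zeta> 1 u) * \<zeta> 2 v"
  unfolding \<zeta>_nabla sum_3 conn_def conn_matrix_def vector_3 by (simp_all add: algebra_simps)

lemma bilinear_nabla: "bilinear (nabla s a)"
  unfolding bilinear_def
proof (intro conjI allI linearI)
  fix u v w c
  show "nabla s a u (v + w) = nabla s a u v + nabla s a u w"
    by (rule coframe_eqI) (simp add: \<zeta>_nabla sum.distrib algebra_simps)
  show "nabla s a u (c *\<^sub>R v) = c *\<^sub>R nabla s a u v"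
    by (rule coframe_eqI) (simp add: \<zeta>_nabla sum_distrib_left algebra_simps)
  show "nabla s a (u + v) w = nabla s a u w + nabla s a v w"
  proof (rule coframe_eqI)
    fix j show "\<zeta> j (nabla s a (u + v) w) = \<zeta> j (nabla s a u w + nabla s a v w)"
      using exhaust_3[of j] by (elim disjE) (simp_all add: \<zeta>_nabla_3 divide_inverse algebra_simps)
  qed
  show "nabla s a (c *\<^sub>R u) w = c *\<^sub>R nabla s a u w"
  proof (rule coframe_eqI)
    fix j show "\<zeta> j (nabla s a (c *\<^sub>R u) w) = \<zeta> j (c *\<^sub>R nabla s a u w)"
      using exhaust_3[of j] by (elim disjE) (simp_all add: \<zeta>_nabla_3 divide_inverse algebra_simps)
  qed
qed

lemma nabla_J: "nabla s a u (J v) = J (nabla s a u v)"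
  by (rule coframe_eqI) (simp add: \<zeta>_nabla sum_distrib_left algebra_simps)

lemma nabla_metric:
  assumes "0 < a"
  shows "metric a (nabla s a u v) w + metric a v (nabla s a u w) = 0"
proof -
  define b :: complex where "b = of_real (1 / a)"
  define A :: complex where "A = of_real a"
  have Ab: "A * b = 1" "cnj b = b" using assms by (auto simp: A_def b_def)
  \<comment> \<open>The full Hermitian form is parallel, not just its real part; this is a
    polynomial identity modulo \<open>A * b = 1\<close>.\<close>
  define H where "H p q = A * (\<zeta> 1 p * cnj (\<zeta> 1 q) + \<zeta> 2 p * cnj (\<zeta> 2 q)) + \<zeta> 3 p * cnj (\<zeta> 3 q)" for p q
  have "H (nabla s a u v) w + H v (nabla s a u w) = 0"
    unfolding H_def \<zeta>_nabla_3 b_def[symmetric] complex_cnj_add complex_cnj_mult complex_cnj_diff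
      complex_cnj_complex_of_real complex_cnj_cnj complex_cnj_one Ab(2)
    using Ab(1) by algebra
  then have "Re (H (nabla s a u v) w + H v (nabla s a u w)) = 0" by simp
  then show ?thesis by (simp only: H_def A_def metric_def plus_complex.sel)
qed

lemma hermitian_nabla: "0 < a \<Longrightarrow> hermitian_connection J (metric a) (nabla s a)"
  by (simp add: hermitian_connection_def bilinear_nabla nabla_metric nabla_J)

lemma chern_nabla: "0 < a \<Longrightarrow> is_chern br J (metric a) (nabla 0 a)"
  unfolding is_chern_def
proof (intro conjI allI hermitian_nabla coframe_eqI)
  fix u v j
  show "\<zeta> j (torsion br (nabla 0 a) (J u) (J v)) = \<zeta> j (- torsion br (nabla 0 a) u v)"
    using exhaust_3[of j]
    by (elim disjE) (simp_all add: torsion_def \<zeta>_nabla_3 two_form_def, simp_all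
        add: divide_inverse algebra_simps)
qed

lemma bismut_nabla:
  assumes "0 < a"
  shows "is_bismut br J (metric a) (nabla 1 a)"
  unfolding is_bismut_def
proof (intro conjI allI hermitian_nabla assms)
  fix u v w
  show "metric a (torsion br (nabla 1 a) u v) w = - metric a (torsion br (nabla 1 a) u w) v"
    using assms
    by (simp add: metric_def torsion_def \<zeta>_nabla_3 two_form_def, simp add: field_simps)
qed

lemma nabla_affine: "nabla s a u v = (1 - s) *\<^sub>R nabla 0 a u v + s *\<^sub>R nabla 1 a u v"
proof (rule coframe_eqI)
  fix j show "\<zeta> j (nabla s a u v) = \<zeta> j ((1 - s) *\<^sub>R nabla 0 a u v + s *\<^sub>R nabla 1 a u v)"
    using exhaust_3[of j] by (elim disjE) (simp_all add: \<zeta>_nabla_3 divide_inverse algebra_simps)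
qed

text \<open>The explicit connections have the characterising properties, so uniqueness evaluates the
  definite descriptions; \<open>(1 - \<tau>) / 2\<close> is the weight of the Bismut
  connection.\<close>

lemma gauduchon_nabla:
  assumes "0 < a"
  shows "gauduchon_connection br J (metric a) \<tau> = nabla ((1 - \<tau>) / 2) a"
proof -
  note pos = metric_pos[OF assms]
  have chern: "chern_connection br J (metric a) = nabla 0 a"
    unfolding chern_connection_def
    by (rule the_equality, rule chern_nabla[OF assms],
      rule is_chern_unique[OF bilinear_metric pos metric_J linear_J J_J _ chern_nabla[OF assms]])
  have bismut: "bismut_connection br J (metric a) = nabla 1 a"
    unfolding bismut_connection_def
    by (rule the_equality, rule bismut_nabla[OF assms],
      rule is_bismut_unique[OF bilinear_metric metric_sym pos metric_J linear_J J_J _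
          bismut_nabla[OF assms]])
  have "(1 + \<tau>) / 2 = 1 - (1 - \<tau>) / 2" by (simp add: field_simps)
  then show ?thesis
    by (intro ext) (simp only: gauduchon_connection_def chern bismut nabla_affine[of "(1 - \<tau>) / 2"])
qed

section \<open>Curvature matrices in the coframe\<close>

abbreviation \<psi>' :: "V6 \<Rightarrow> V6 \<Rightarrow> complex" where
  "\<psi>' \<equiv> two_form \<zeta> (- 1) 0 (- of_real lam) (- cnj z) 0 (of_real \<rho>)"

lemma cnj_\<psi>: "cnj (\<psi> u v) = \<psi>' u v"
  by (simp add: two_form_def algebra_simps)

lemma conn_br:
  "conn s a (br u v) = bracket_matrix (of_real s) (of_real (1 / a)) (of_real lam) z (\<psi> u v) (\<psi>' u v)"
  by (simp add: conn_def conn_matrix_def bracket_matrix_def M10_def M01_def vec_eq_iff forall_3 vector_3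
      flip: cnj_\<psi>)

definition curv :: "real \<Rightarrow> real \<Rightarrow> V6 \<Rightarrow> V6 \<Rightarrow> complex ^ 3 ^ 3" where
  "curv s a u v = commut (conn s a u) (conn s a v) - conn s a (br u v)"

lemma \<zeta>_curvature: "\<zeta> j (curvature br (nabla s a) u v w) = (\<Sum>k\<in>UNIV. curv s a u v $ j $ k * \<zeta> k w)"
  by (simp add: curvature_def \<zeta>_nabla curv_def commut_def matrix_matrix_mult_def sum_3 algebra_simps)

lemma \<psi>_skew: "\<psi> v u = - \<psi> u v" and \<psi>'_skew: "\<psi>' v u = - \<psi>' u v"
  by (simp_all add: two_form_def algebra_simps)

lemma curv_skew_args: "curv s a v u = - curv s a u v"
proof -
  have "conn s a (br v u) = - conn s a (br u v)"
    unfolding conn_br \<psi>_skew[of v u] \<psi>'_skew[of v u]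
    by (simp add: bracket_matrix_def vec_eq_iff algebra_simps)
  then show ?thesis by (simp add: curv_def commut_def)
qed

lemma curvature_skew: "curvature br (nabla s a) v u w = - curvature br (nabla s a) u v w"
  by (rule coframe_eqI) (simp add: \<zeta>_curvature curv_skew_args[of s a v u] sum_negf)

text \<open>The connection matrices lie in the unitary Lie algebra of the form diag(a, a, 1), which
  is closed under commutators. Skewness with respect to this form produces the factors
  \<open>a\<close>.\<close>

lemma curv_skew_hermitian:
  assumes "0 < a"
  shows "Re (curv s a u v $ 1 $ 1) = 0" "Re (curv s a u v $ 2 $ 2) = 0" "Re (curv s a u v $ 3 $ 3) = 0"
    "curv s a u v $ 2 $ 1 = - cnj (curv s a u v $ 1 $ 2)"
    "curv s a u v $ 3 $ 1 = - of_real a * cnj (curv s a u v $ 1 $ 3)"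
    "curv s a u v $ 3 $ 2 = - of_real a * cnj (curv s a u v $ 2 $ 3)"
proof -
  have L: "conn s a w $ 1 $ 1 = - cnj (conn s a w $ 1 $ 1)"
       "conn s a w $ 2 $ 2 = - cnj (conn s a w $ 2 $ 2)"
    "conn s a w $ 3 $ 3 = 0"
    "conn s a w $ 2 $ 1 = - cnj (conn s a w $ 1 $ 2)"
    "conn s a w $ 3 $ 1 = - of_real a * cnj (conn s a w $ 1 $ 3)"
    "conn s a w $ 3 $ 2 = - of_real a * cnj (conn s a w $ 2 $ 3)" for w
    using assms by (simp_all add: conn_def conn_matrix_def vector_3) (simp_all add: field_simps)
  note expand = curv_def commut_def matrix_matrix_mult_def vec_lambda_beta vector_minus_component
    sum_3 L(3-) complex_cnj_add complex_cnj_diff complex_cnj_mult complex_cnj_minus complex_cnj_cnj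
    complex_cnj_complex_of_real complex_cnj_zero
  note diag = L(1)[of u] L(2)[of u] L(1)[of v] L(2)[of v] L(1)[of "br u v"] L(2)[of "br u v"]
  show "curv s a u v $ 2 $ 1 = - cnj (curv s a u v $ 1 $ 2)"
    unfolding expand using diag by algebra
  show "curv s a u v $ 3 $ 1 = - of_real a * cnj (curv s a u v $ 1 $ 3)"
    unfolding expand using diag by algebra
  show "curv s a u v $ 3 $ 2 = - of_real a * cnj (curv s a u v $ 2 $ 3)"
    unfolding expand using diag by algebra
  have "curv s a u v $ 1 $ 1 + cnj (curv s a u v $ 1 $ 1) = 0"
    unfolding expand using diag by algebra
  moreover have "curv s a u v $ 2 $ 2 + cnj (curv s a u v $ 2 $ 2) = 0"
    unfolding expand using diag by algebra
  moreover have "curv s a u v $ 3 $ 3 + cnj (curv s a u v $ 3 $ 3) = 0"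
    unfolding expand by (simp add: algebra_simps)
  ultimately show "Re (curv s a u v $ 1 $ 1) = 0" "Re (curv s a u v $ 2 $ 2) = 0"
      "Re (curv s a u v $ 3 $ 3) = 0"
    by (simp_all add: complex_eq_iff)
qed

section \<open>Curvature in an orthonormal frame\<close>

text \<open>Ordered in pairs v, J v, one pair for each complex direction; the vectors along
  \<zeta>^1 and \<zeta>^2 have to be normalised by \<open>1 / sqrt a\<close>.\<close>

definition frame :: "real \<Rightarrow> nat \<Rightarrow> V6" where
  "frame a i = (let q = of_real (1 / sqrt a)
     in [vec_of q 0 0, vec_of (\<i> * q) 0 0, vec_of 0 q 0, vec_of 0 (\<i> * q) 0, vec_of 0 0 1,
         vec_of 0 0 \<i>] ! i)"

lemma frame_simps:
  "frame a 0 = vec_of (of_real (1 / sqrt a)) 0 0"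
      "frame a (Suc 0) = vec_of (\<i> * of_real (1 / sqrt a)) 0 0"
  "frame a 2 = vec_of 0 (of_real (1 / sqrt a)) 0" "frame a 3 = vec_of 0 (\<i> * of_real (1 / sqrt a)) 0"
  "frame a 4 = vec_of 0 0 1" "frame a 5 = vec_of 0 0 \<i>"
  by (simp_all add: frame_def)

lemma orthonormal_frame:
  assumes "0 < a"
  shows "orthonormal_frame (metric a) (frame a)"
proof -
  have "\<forall>i\<in>{0, Suc 0, 2, 3, 4, 5}. \<forall>j\<in>{0, Suc 0, 2, 3, 4, 5}. metric a (frame a i) (frame a j) =
      (if i = j then 1 else 0)"
    using assms by (simp add: frame_simps metric_def divide_simps)
  moreover have "i \<in> {0, Suc 0, 2, 3, 4, 5}" if "i < 6" for i :: nat
    using that by auto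
  ultimately show ?thesis unfolding orthonormal_frame_def by blast
qed

lemma metric_Re_Im: "metric a u v = a * (Re (\<zeta> 1 u) * Re (\<zeta> 1 v) + Im (\<zeta> 1 u) * Im (\<zeta> 1 v)
    + Re (\<zeta> 2 u) * Re (\<zeta> 2 v) + Im (\<zeta> 2 u) * Im (\<zeta> 2 v))
    + Re (\<zeta> 3 u) * Re (\<zeta> 3 v) + Im (\<zeta> 3 u) * Im (\<zeta> 3 v)"
  by (simp add: metric_def algebra_simps)

text \<open>For real skew matrices the sum over i < j of products of entries is minus half the real
  trace of the product. For operators commuting with \<open>J\<close> that trace is twice the real
  part of the complex one, and the trace of a product of two skew-Hermitian matrices is
  real.\<close>

lemma curv_form_frame_pairing:
  assumes "0 < a"
  shows "(\<Sum>(i, j)\<in>{(i, j). i < j \<and> j < 6}. curv_form br (nabla s a) (metric a) (frame a) i j [u, v]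
      * curv_form br (nabla s a) (metric a) (frame a) i j [u', v']) = - trace
          (curv s a u v ** curv s a u' v')"
proof -
  define q where "q = 1 / sqrt a"
  have q: "a * q * q = 1" using assms by (simp add: q_def)
  have fr: "frame a 0 = vec_of (of_real q) 0 0" "frame a 1 = vec_of (\<i> * of_real q) 0 0"
    "frame a 2 = vec_of 0 (of_real q) 0" "frame a 3 = vec_of 0 (\<i> * of_real q) 0"
    "frame a 4 = vec_of 0 0 1" "frame a 5 = vec_of 0 0 \<i>"
    by (simp_all add: frame_simps q_def)
  define G where "G u v i j = metric a (curvature br (nabla s a) u v (frame a j)) (frame a i)"
      for u v i j
  have form: "curv_form br (nabla s a) (metric a) (frame a) i j [u, v] = of_real (G u v i j)"
      for u v i j
    by (simp add: curv_form_def G_def)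
  note expand = G_def metric_Re_Im \<zeta>_curvature fr \<zeta>_vec_of sum_3 times_complex.sel plus_complex.sel
    Re_complex_of_real Im_complex_of_real zero_complex.sel one_complex.sel imaginary_unit.sel
  have G: "G u v 0 1 = - Im (curv s a u v $ 1 $ 1)" "G u v 2 3 = - Im (curv s a u v $ 2 $ 2)"
    "G u v 0 2 = Re (curv s a u v $ 1 $ 2)" "G u v 0 3 = - Im (curv s a u v $ 1 $ 2)"
    "G u v 1 2 = Im (curv s a u v $ 1 $ 2)" "G u v 1 3 = Re (curv s a u v $ 1 $ 2)" for u v
    unfolding expand using q by algebra+
  \<comment> \<open>Entries mixing \<zeta>^3 with the other directions keep the factor
    \<open>a * q\<close>; its square is \<open>a\<close>, the factor in the skewness
    relations.\<close>
  have G': "G u v 4 5 = - Im (curv s a u v $ 3 $ 3)"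
    "G u v 0 4 = a * q * Re (curv s a u v $ 1 $ 3)" "G u v 0 5 = - a * q * Im (curv s a u v $ 1 $ 3)"
    "G u v 1 4 = a * q * Im (curv s a u v $ 1 $ 3)" "G u v 1 5 = a * q * Re (curv s a u v $ 1 $ 3)"
    "G u v 2 4 = a * q * Re (curv s a u v $ 2 $ 3)" "G u v 2 5 = - a * q * Im (curv s a u v $ 2 $ 3)"
    "G u v 3 4 = a * q * Im (curv s a u v $ 2 $ 3)" "G u v 3 5 = a * q * Re (curv s a u v $ 2 $ 3)"
    for u v
    unfolding expand by simp_all
  note skew = curv_skew_hermitian[OF assms]
  note expand_trace = sum_pairs_6 G G' trace_def matrix_matrix_mult_def vec_lambda_beta sum_3
    skew(4-) plus_complex.sel uminus_complex.sel times_complex.sel complex_cnj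
    Re_complex_of_real Im_complex_of_real cnj.sel skew(1-3)
  have "(\<Sum>(i, j)\<in>{(i, j). i < j \<and> j < 6}. of_real (G u v i j) * of_real (G u' v' i j)) =
    - trace (curv s a u v ** curv s a u' v')"
  proof (rule complex_eqI)
    show "Re (\<Sum>(i, j)\<in>{(i, j). i < j \<and> j < 6}. of_real (G u v i j) * of_real (G u' v' i j)) =
      Re (- trace (curv s a u v ** curv s a u' v'))"
      unfolding expand_trace
      using q by algebra
    show "Im (\<Sum>(i, j)\<in>{(i, j). i < j \<and> j < 6}. of_real (G u v i j) * of_real (G u' v' i j)) =
      Im (- trace (curv s a u v ** curv s a u' v'))"
      unfolding expand_trace
      by algebra
  qed
  then show ?thesis by (simp only: form)
qed

lemma curv_form_skew:
  "curv_form br (nabla s a) (metric a) e i j [v, u] =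
      - curv_form br (nabla s a) (metric a) e i j [u, v]"
  by (simp add: curv_form_def curvature_skew[of s a v u] bilinear_lneg[OF bilinear_metric])

text \<open>The polynomial F(\<tau>) at \<open>s = (1 - \<tau>) / 2\<close>; the factor
  \<open>s\<close> makes it vanish at the Chern connection.\<close>

definition trace_coeff :: "real \<Rightarrow> real" where
  "trace_coeff s = s * (2 * x * (1 + x\<^sup>2 + y\<^sup>2) * (1 - s + s\<^sup>2)
      - s * (1 + lam\<^sup>2 + x\<^sup>2 + y\<^sup>2) * (\<rho>\<^sup>2 + lam\<^sup>2 - 2 * x - 4 * \<rho>\<^sup>2 * (1 - s)))"

lemma tr_curv_wedge_curv_nabla:
  assumes "0 < a"
  shows "tr_curv_wedge_curv br (nabla s a) (metric a) (frame a) [v0, v1, v2, v3] =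
    - of_real (2 * trace_coeff s / a\<^sup>2) * vol4 \<zeta> v0 v1 v2 v3"
proof -
  let ?c = "curv_form br (nabla s a) (metric a) (frame a)"
  let ?t = "\<lambda>u v u' v'. trace (curv s a u v ** curv s a u' v')"
  have P: "(\<Sum>p\<in>{(i, j). i < j \<and> j < 6}. ?c (fst p) (snd p) [u, v] * ?c (fst p) (snd p) [u', v']) =
      - ?t u v u' v'"
    for u v u' v'
    using curv_form_frame_pairing[OF assms, of s u v u' v'] by (simp add: case_prod_beta)
  have curv: "curv s a u v = commut (conn s a u) (conn s a v)
      - bracket_matrix (of_real s) (of_real (1 / a)) (of_real lam) z (\<psi> u v) (\<psi>' u v)" for u v
    by (simp only: curv_def conn_br)
  have zz: "z + cnj z = of_real (2 * x)" "z * cnj z = of_real (x\<^sup>2 + y\<^sup>2)"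
    by (simp_all add: complex_eq_iff power2_eq_square)
  have "tr_curv_wedge_curv br (nabla s a) (metric a) (frame a) [v0, v1, v2, v3] =
    (\<Sum>p\<in>{(i, j). i < j \<and> j < 6}. wedge22 (\<lambda>u v. ?c (fst p) (snd p) [u, v])
        (\<lambda>u v. ?c (fst p) (snd p) [u, v]) v0 v1 v2 v3)"
    unfolding tr_curv_wedge_curv_def case_prod_beta by (intro sum.cong refl wedge_2_2 curv_form_skew)
  also have "\<dots> = - ?t v0 v1 v2 v3 + ?t v0 v2 v1 v3 - ?t v0 v3 v1 v2 - ?t v1 v2 v0 v3
      + ?t v1 v3 v0 v2 - ?t v2 v3 v0 v1"
    unfolding wedge22_def sum.distrib sum_subtractf P by simp
  \<comment> \<open>Symmetry of the trace identifies complementary shuffles, leaving three of the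
    six.\<close>
  also have "\<dots> = - 2 * (?t v0 v1 v2 v3 - ?t v0 v2 v1 v3 + ?t v0 v3 v1 v2)"
    using trace_mul_sym[of "curv s a v0 v1" "curv s a v2 v3"]
        trace_mul_sym[of "curv s a v0 v2" "curv s a v1 v3"]
      trace_mul_sym[of "curv s a v0 v3" "curv s a v1 v2"] by simp
  also have "\<dots> = - 2 * ((of_real (1 / a))\<^sup>2 * of_real s
      * ((z + cnj z) * (1 + z * cnj z) * (1 - of_real s + (of_real s)\<^sup>2)
      - of_real s * (1 + (of_real lam)\<^sup>2 + z * cnj z) *
          ((of_real \<rho>)\<^sup>2 + (of_real lam)\<^sup>2 - (z + cnj z) - 4 * (of_real \<rho>)\<^sup>2 * (1 - of_real s))) *
          vol4 \<zeta> v0 v1 v2 v3)"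
    unfolding curv conn_def trace_curvature_alt ..
  also have "\<dots> = - of_real (2 * trace_coeff s / a\<^sup>2) * vol4 \<zeta> v0 v1 v2 v3"
  proof -
    have "complex_of_real (2 * trace_coeff s / a\<^sup>2) = 2 * (of_real (1 / a))\<^sup>2 * of_real (trace_coeff s)"
      by (simp add: power_divide)
    then show ?thesis
      unfolding zz trace_coeff_def of_real_mult of_real_add of_real_diff of_real_power of_real_1
          of_real_numeral
      by algebra
  qed
  finally show ?thesis .
qed

section \<open>The reduced flow\<close>

text \<open>The part of \<open>\<omega>\<^sup>2\<close> involving \<open>\<zeta>\<^sup>3\<close>, which is linear in \<open>a\<close>.\<close>

definition base_form :: form where
  "base_form vs = 2 * wedge22 (\<lambda>u v. \<i> / 2 * two_form \<zeta> 1 0 0 1 0 0 u v)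
     (\<lambda>u v. \<i> / 2 * (\<zeta> 3 u * cnj (\<zeta> 3 v) - \<zeta> 3 v * cnj (\<zeta> 3 u))) (vs ! 0) (vs ! 1) (vs ! 2) (vs ! 3)"

lemma fundamental_form_skew: "fundamental_form \<zeta> h [v, u] = - fundamental_form \<zeta> h [u, v]"
  by (simp add: fundamental_form_def z_zbar_pair sum_3 algebra_simps)

text \<open>Write \<omega> = a \<theta> + \<phi> with \<phi> the \<zeta>^3-part: \<phi> \<and>
  \<phi> = 0, \<theta> \<and> \<theta> is a multiple of \<open>vol4\<close>, and the cross term is
  \<open>base_form\<close>.\<close>

lemma omega_wedge_omega:
  "wedge 2 (omega a) (omega a) [v0, v1, v2, v3] =
      - of_real (a\<^sup>2 / 2) * vol4 \<zeta> v0 v1 v2 v3 + of_real a * base_form [v0, v1, v2, v3]"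
proof -
  define \<theta> where "\<theta> = (\<lambda>u v. \<i> / 2 * two_form \<zeta> 1 0 0 1 0 0 u v)"
  define \<phi> where "\<phi> = (\<lambda>u v. \<i> / 2 * (\<zeta> 3 u * cnj (\<zeta> 3 v) - \<zeta> 3 v * cnj (\<zeta> 3 u)))"
  have om: "omega a [u, v] = of_real a * \<theta> u v + \<phi> u v" for u v
    by (simp add: omega_pair \<theta>_def \<phi>_def two_form_def algebra_simps)
  have \<theta>: "wedge22 \<theta> \<theta> v0 v1 v2 v3 = - vol4 \<zeta> v0 v1 v2 v3 / 2"
  proof -
    have "wedge22 \<theta> \<theta> v0 v1 v2 v3 =
        (\<i> / 2)\<^sup>2 * wedge22 (two_form \<zeta> 1 0 0 1 0 0) (two_form \<zeta> 1 0 0 1 0 0) v0 v1 v2 v3"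
      unfolding wedge22_def \<theta>_def by algebra
    also have "\<dots> = - vol4 \<zeta> v0 v1 v2 v3 / 2" unfolding wedge_two_form by (simp add: power2_eq_square)
    finally show ?thesis .
  qed
  have \<phi>: "wedge22 \<phi> \<phi> v0 v1 v2 v3 = 0" unfolding wedge22_def \<phi>_def by (simp add: algebra_simps)
  have "wedge 2 (omega a) (omega a) [v0, v1, v2, v3] =
      wedge22 (\<lambda>u v. omega a [u, v]) (\<lambda>u v. omega a [u, v]) v0 v1 v2 v3"
    unfolding omega_def by (intro wedge_2_2 fundamental_form_skew)
  also have "\<dots> = (of_real a)\<^sup>2 * wedge22 \<theta> \<theta> v0 v1 v2 v3
      + of_real a * (2 * wedge22 \<theta> \<phi> v0 v1 v2 v3) + wedge22 \<phi> \<phi> v0 v1 v2 v3"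
    unfolding om wedge22_def by algebra
  finally show ?thesis unfolding \<theta> \<phi> by (simp add: base_form_def \<theta>_def \<phi>_def)
qed

lemma Psi_norm_metric_matrix: "0 < a \<Longrightarrow> Psi_norm (metric_matrix a) = sqrt 8 / a"
  by (simp add: Psi_norm_def metric_matrix_def det_3 vector_3 real_sqrt_divide real_sqrt_mult)

text \<open>The norm of \<Psi> cancels one power of \<open>a\<close>, which makes the \<zeta>^3-part
  constant and the remaining coefficient linear in \<open>a\<close>.\<close>

lemma weighted_square:
  assumes "0 < a"
  shows "of_real (Psi_norm (metric_matrix a)) * wedge 2 (omega a) (omega a) [v0, v1, v2, v3] =
    of_real (sqrt 8) * (base_form [v0, v1, v2, v3] - of_real (a / 2) * vol4 \<zeta> v0 v1 v2 v3)"
  unfolding omega_wedge_omega Psi_norm_metric_matrix[OF assms]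
  using assms by (simp add: field_simps power2_eq_square)

lemma positive_hermitian_metric_matrix:
  assumes "0 < a"
  shows "positive_hermitian (metric_matrix a)"
  unfolding positive_hermitian_def
proof (intro conjI allI impI)
  show "metric_matrix a $ l $ j = cnj (metric_matrix a $ j $ l)" for j l
    using exhaust_3[of j] exhaust_3[of l] by (auto simp: metric_matrix_def vector_3)
  fix w :: "complex ^ 3" assume "w \<noteq> 0"
  then have "w $ 1 \<noteq> 0 \<or> w $ 2 \<noteq> 0 \<or> w $ 3 \<noteq> 0" by (simp add: vec_eq_iff forall_3)
  then have "0 < (cmod (w $ 1))\<^sup>2 + (cmod (w $ 2))\<^sup>2 \<or> 0 < (cmod (w $ 3))\<^sup>2"
    by (auto simp: sum_power2_gt_zero_iff)
  moreover have "Re (\<Sum>j\<in>UNIV. \<Sum>l\<in>UNIV. metric_matrix a $ j $ l * w $ j * cnj (w $ l)) =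
     a * ((cmod (w $ 1))\<^sup>2 + (cmod (w $ 2))\<^sup>2) + (cmod (w $ 3))\<^sup>2"
    by (simp add: metric_matrix_def sum_3 vector_3 cmod_power2, simp add: power2_eq_square
        algebra_simps)
  ultimately show "0 < Re (\<Sum>j\<in>UNIV. \<Sum>l\<in>UNIV. metric_matrix a $ j $ l * w $ j * cnj (w $ l))"
    using assms by (auto intro: add_pos_nonneg add_nonneg_pos)
qed

section \<open>The form \<i>\<partial>\<partial>-bar \<omega>\<close>

abbreviation hol :: "3 \<Rightarrow> bool \<times> (V6 \<Rightarrow> complex)" where "hol j \<equiv> (True, \<zeta> j)"
abbreviation anti :: "3 \<Rightarrow> bool \<times> (V6 \<Rightarrow> complex)" where "anti j \<equiv> (False, \<lambda>v. cnj (\<zeta> j v))"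

lemma bideg_part_coframe:
  assumes "set L \<subseteq> range hol \<union> range anti"
  shows "bideg_part J p (alt_form L) vs = (if length (filter fst L) = p then alt_form L vs else 0)"
  by (rule bideg_part_alt_form) (use assms in auto)

text \<open>As \<zeta>^1 and \<zeta>^2 are closed, only \<zeta>^3 \<and> cnj \<zeta>^3 contributes,
  and \<open>a\<close> disappears. Each \<open>alt_form\<close> has pure type, so the bidegree parts
  can be read off.\<close>

lemma d_omega: "ext_d br (omega a) [u, v, w] = \<i> / 2 *
    (alt_form [hol 1, anti 1, anti 3] [u, v, w] + of_real lam * alt_form [hol 1, anti 2, anti 3]
        [u, v, w]
     + z * alt_form [hol 2, anti 2, anti 3] [u, v, w] + of_real \<rho> * alt_form
         [hol 1, hol 2, anti 3] [u, v, w]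
     + alt_form [hol 1, anti 1, hol 3] [u, v, w] + of_real lam * alt_form [hol 2, anti 1, hol 3]
         [u, v, w]
     + cnj z * alt_form [hol 2, anti 2, hol 3] [u, v, w] - of_real \<rho> * alt_form
         [anti 1, anti 2, hol 3] [u, v, w])"
proof -
  have om: "omega a [br u v, w] = \<i> / 2 * (\<psi>' u v * \<zeta> 3 w - \<psi> u v * cnj (\<zeta> 3 w))" for u v w
    by (simp add: omega_pair cnj_\<psi> algebra_simps)
  have eq: "ext_d br (omega a) [u, v, w] = \<i> / 2 * (\<psi> u v * cnj (\<zeta> 3 w) - \<psi>' u v * \<zeta> 3 w
     - (\<psi> u w * cnj (\<zeta> 3 v) - \<psi>' u w * \<zeta> 3 v) + (\<psi> v w * cnj (\<zeta> 3 u) - \<psi>' v w * \<zeta> 3 u))"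
    unfolding ext_d_3 om by (simp add: algebra_simps)
  show ?thesis
    unfolding eq two_form_def alt_form_3 alt_form_2 fst_conv snd_conv
    by (rule arg_cong[where f = "\<lambda>t. \<i> / 2 * t"]) algebra
qed

lemma delbar_omega: "delbar br J 1 (omega a) [u, v, w] = \<i> / 2 *
    (alt_form [hol 1, anti 1, anti 3] [u, v, w] + of_real lam * alt_form [hol 1, anti 2, anti 3]
        [u, v, w]
     + z * alt_form [hol 2, anti 2, anti 3] [u, v, w] - of_real \<rho> * alt_form
         [anti 1, anti 2, hol 3] [u, v, w])"
proof -
  have "delbar br J 1 (omega a) [u, v, w] = bideg_part J 1 (\<lambda>us. \<i> / 2 *
    (alt_form [hol 1, anti 1, anti 3] us + (of_real lam * alt_form [hol 1, anti 2, anti 3] us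
     + (z * alt_form [hol 2, anti 2, anti 3] us + (of_real \<rho> * alt_form [hol 1, hol 2, anti 3] us
     + (alt_form [hol 1, anti 1, hol 3] us + (of_real lam * alt_form [hol 2, anti 1, hol 3] us
     + (cnj z * alt_form [hol 2, anti 2, hol 3] us + (- of_real \<rho>) * alt_form
         [anti 1, anti 2, hol 3] us)))))))) [u, v, w]"
    unfolding delbar_def
  proof (rule bideg_part_cong)
    fix us :: "V6 list" assume "length us = length [u, v, w]"
    then obtain a' b' c' where us: "us = [a', b', c']" by (auto simp: length_Suc_conv)
    show "ext_d br (omega a) us = \<i> / 2 *
    (alt_form [hol 1, anti 1, anti 3] us + (of_real lam * alt_form [hol 1, anti 2, anti 3] us
     + (z * alt_form [hol 2, anti 2, anti 3] us + (of_real \<rho> * alt_form [hol 1, hol 2, anti 3] us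
     + (alt_form [hol 1, anti 1, hol 3] us + (of_real lam * alt_form [hol 2, anti 1, hol 3] us
     + (cnj z * alt_form [hol 2, anti 2, hol 3] us + (- of_real \<rho>) * alt_form
         [anti 1, anti 2, hol 3] us)))))))"
      unfolding us d_omega by algebra
  qed
  also have "\<dots> = \<i> / 2 *
    (alt_form [hol 1, anti 1, anti 3] [u, v, w] + of_real lam * alt_form [hol 1, anti 2, anti 3]
        [u, v, w]
     + z * alt_form [hol 2, anti 2, anti 3] [u, v, w] - of_real \<rho> * alt_form
         [anti 1, anti 2, hol 3] [u, v, w])"
    unfolding bideg_part_cmult bideg_part_add
    by (subst bideg_part_coframe, (simp; fail))+ (simp del: alt_form.simps)
  finally show ?thesis .
qed

lemma d_delbar_omega: "ext_d br (delbar br J 1 (omega a)) [v0, v1, v2, v3] =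
   \<i> / 2 * of_real (\<rho>\<^sup>2 + lam\<^sup>2 - 2 * x) * vol4 \<zeta> v0 v1 v2 v3"
proof -
  have zz: "complex_of_real (\<rho>\<^sup>2 + lam\<^sup>2 - 2 * x) = (of_real \<rho>)\<^sup>2 + (of_real lam)\<^sup>2 - (z + cnj z)"
    by (simp add: complex_eq_iff power2_eq_square)
  \<comment> \<open>\<beta> is the (1,1)-part of d\<zeta>^3 and \<gamma> the conjugate of \<zeta>^1
    \<and> \<zeta>^2. Pairing \<psi>' with \<beta> gives \<open>lam\<^sup>2 - 2 * x\<close>, and
    \<psi> with \<gamma> gives \<open>- \<rho>\<close>.\<close>
  define \<beta> where "\<beta> = two_form \<zeta> 1 (of_real lam) 0 z 0 0"
  define \<gamma> where "\<gamma> = two_form \<zeta> 0 0 0 0 0 1"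
  have br: "delbar br J 1 (omega a) [br u v, w, t] =
      \<i> / 2 * (of_real \<rho> * \<psi> u v * \<gamma> w t - \<psi>' u v * \<beta> w t)" for u v w t
    unfolding delbar_omega alt_form_3 alt_form_2 fst_conv snd_conv \<zeta>_br complex_cnj_minus cnj_\<psi>
      complex_cnj_zero
    by (rule arg_cong[where f = "\<lambda>t. \<i> / 2 * t"]) (simp add: \<beta>_def \<gamma>_def two_form_def algebra_simps)
  have "ext_d br (delbar br J 1 (omega a)) [v0, v1, v2, v3] =
      \<i> / 2 * (wedge22 \<psi>' \<beta> v0 v1 v2 v3 - of_real \<rho> * wedge22 \<psi> \<gamma> v0 v1 v2 v3)"
    unfolding ext_d_4 br wedge22_def by (simp add: algebra_simps)
  also have "\<dots> = \<i> / 2 * (of_real (\<rho>\<^sup>2 + lam\<^sup>2 - 2 * x) * vol4 \<zeta> v0 v1 v2 v3)"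
    unfolding \<beta>_def \<gamma>_def wedge_two_form zz
    by (rule arg_cong[where f = "\<lambda>t. \<i> / 2 * t"]) (simp add: algebra_simps power2_eq_square)
  finally show ?thesis by (simp only: mult.assoc)
qed

text \<open>The differential of \<partial>-bar \<omega> is already of type (2,2), so the projection
  in \<open>del\<close> does not change it.\<close>

lemma del_delbar_omega:
  assumes "length vs = 4"
  shows "\<i> * del br J 1 (delbar br J 1 (omega a)) vs =
      - of_real ((\<rho>\<^sup>2 + lam\<^sup>2 - 2 * x) / 2) * vol4 \<zeta> (vs ! 0) (vs ! 1) (vs ! 2) (vs ! 3)"
proof -
  let ?L = "[hol 1, anti 1, hol 2, anti 2]"
  define c where "c = \<i> / 2 * of_real (\<rho>\<^sup>2 + lam\<^sup>2 - 2 * x)"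
  have "del br J 1 (delbar br J 1 (omega a)) vs = bideg_part J 2 (\<lambda>us. c * alt_form ?L us) vs"
    unfolding del_def Suc_1
  proof (rule bideg_part_cong)
    fix us :: "V6 list" assume "length us = length vs"
    then obtain p q r t where us: "us = [p, q, r, t]" using list_length_4 assms by metis
    show "ext_d br (delbar br J 1 (omega a)) us = c * alt_form ?L us"
      unfolding us c_def d_delbar_omega vol4_alt_form ..
  qed
  also have "\<dots> = c * alt_form ?L vs"
    unfolding bideg_part_cmult by (subst bideg_part_coframe) (simp_all del: alt_form.simps)
  also have "alt_form ?L vs = vol4 \<zeta> (vs ! 0) (vs ! 1) (vs ! 2) (vs ! 3)"
    using list_length_4[OF assms] by (auto simp: vol4_alt_form simp del: alt_form.simps)
  finally have eq: "del br J 1 (delbar br J 1 (omega a)) vs =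
      c * vol4 \<zeta> (vs ! 0) (vs ! 1) (vs ! 2) (vs ! 3)" .
  show ?thesis unfolding eq c_def by (simp flip: mult.assoc) (simp add: algebra_simps)
qed

text \<open>The moving part of the left side and both terms on the right are multiples of
  \<open>vol4\<close>, so the equation of 4-forms reduces to a comparison of coefficients.\<close>

lemma anomaly_flow_at_metric_matrix:
  assumes I: "open I" "t \<in> I" and pos: "\<And>s. s \<in> I \<Longrightarrow> 0 < a s"
    and deriv: "(a has_real_derivative D) (at t)"
    and ode: "sqrt 8 * D = \<rho>\<^sup>2 + lam\<^sup>2 - 2 * x - \<alpha>' * trace_coeff ((1 - \<tau>) / 2) / (a t)\<^sup>2"
  shows "anomaly_flow_at br J \<zeta> \<tau> \<alpha>' (\<lambda>s. metric_matrix (a s)) t"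
proof -
  define F where "F = trace_coeff ((1 - \<tau>) / 2)"
  have deriv_vs: "((\<lambda>s.
      of_real (Psi_norm (metric_matrix (a s))) * wedge 2 (omega (a s)) (omega (a s)) vs)
      has_vector_derivative
        \<i> * del br J 1 (delbar br J 1 (omega (a t))) vs
        - of_real (\<alpha>' / 4) * tr_curv_wedge_curv br (nabla ((1 - \<tau>) / 2) (a t)) (metric (a t))
            (frame (a t)) vs) (at t)"
    if "length vs = 4" for vs
  proof -
    from list_length_4[OF that] obtain v0 v1 v2 v3 where vs: "vs = [v0, v1, v2, v3]" by blast
    define V where "V = vol4 \<zeta> v0 v1 v2 v3"
    from has_vector_derivative_of_real[OF DERIV_cdivide[OF deriv, of 2], where 'a = complex]
    have "((\<lambda>s. of_real (sqrt 8) * (base_form vs - of_real (a s / 2) * V)) has_vector_derivative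
        of_real (sqrt 8) * (0 - of_real (D / 2) * V)) (at t)"
      by (intro has_vector_derivative_mult_right has_vector_derivative_diff has_vector_derivative_const
          has_vector_derivative_mult_left)
    \<comment> \<open>The formula for the weighted square requires \<open>0 < a s\<close>, which
      holds near \<open>t\<close> because \<open>I\<close> is open.\<close>
    then have "((\<lambda>s. of_real (Psi_norm (metric_matrix (a s))) * wedge 2 (omega (a s)) (omega (a s)) vs)
        has_vector_derivative of_real (sqrt 8) * (0 - of_real (D / 2) * V)) (at t)"
      by (rule has_vector_derivative_transform_within_open[OF _ I])
          (simp add: weighted_square[OF pos] vs V_def)
    moreover have "of_real (sqrt 8) * (0 - of_real (D / 2) * V) =
        \<i> * del br J 1 (delbar br J 1 (omega (a t))) vs
        - of_real (\<alpha>' / 4) * tr_curv_wedge_curv br (nabla ((1 - \<tau>) / 2) (a t)) (metric (a t))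
            (frame (a t)) vs"
    proof -
      have "of_real (sqrt 8) * (0 - of_real (D / 2) * V) = - of_real (sqrt 8 * D / 2) * V" by simp
      also have "\<dots> = - of_real ((\<rho>\<^sup>2 + lam\<^sup>2 - 2 * x) / 2) * V
          - of_real (\<alpha>' / 4) * (- of_real (2 * F / (a t)\<^sup>2) * V)"
        unfolding ode F_def[symmetric]
            by (simp add: algebra_simps add_divide_distrib diff_divide_distrib)
      finally show ?thesis
        unfolding del_delbar_omega[OF that] unfolding vs tr_curv_wedge_curv_nabla[OF pos[OF I(2)]]
            by (simp add: V_def F_def)
    qed
    ultimately show ?thesis by simp
  qed
  show ?thesis
    unfolding anomaly_flow_at_def Let_def omega_def[symmetric] riem_metric_omega
        gauduchon_nabla[OF pos[OF I(2)]]
    using deriv_vs orthonormal_frame[OF pos[OF I(2)]] by blast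
qed

text \<open>
  The components of \<open>\<parallel>\<Psi>\<parallel>\<omega>\<^sup>2\<close> involving \<open>\<zeta>\<^sup>3\<close> stay constant, so \<open>\<parallel>\<Psi>\<parallel> \<noteq> 0\<close> at the limit; the remaining
  component tends to \<open>0\<close>, so the upper left minor of the limit metric vanishes.
\<close>

lemma anomaly_flow_no_limit_point:
  fixes a :: "real \<Rightarrow> real" and h :: "real \<Rightarrow> complex ^ 3 ^ 3"
  assumes flow: "anomaly_flow_at br J \<zeta> \<tau> \<alpha>' h t" and pos: "positive_hermitian (h t)"
    and F: "F \<le> at t" "F \<noteq> bot"
    and a: "\<forall>\<^sub>F s in F. h s = metric_matrix (a s) \<and> 0 < a s" and lim: "(a \<longlongrightarrow> 0) F"
  shows False
proof -
  define H where "H = h t"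
  let ?G = "\<lambda>vs s. complex_of_real (Psi_norm (h s))
      * wedge 2 (fundamental_form \<zeta> (h s)) (fundamental_form \<zeta> (h s)) vs"
  \<comment> \<open>Differentiability at \<open>t\<close> gives continuity there, so the value at
    \<open>t\<close> is the limit along \<open>F\<close> of the explicit formula with
    \<open>a\<close> tending to 0.\<close>
  have limit: "?G [v0, v1, v2, v3] t = of_real (sqrt 8) * base_form [v0, v1, v2, v3]" for v0 v1 v2 v3
  proof -
    let ?vs = "[v0, v1, v2, v3]"
    have "length ?vs = 4" by simp
    with flow obtain D where "(?G ?vs has_vector_derivative D) (at t)"
      unfolding anomaly_flow_at_def Let_def by blast
    then have "isCont (?G ?vs) t" by (rule has_vector_derivative_continuous)
    then have 1: "(?G ?vs \<longlongrightarrow> ?G ?vs t) F"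
      unfolding isCont_def using F(1) tendsto_mono by blast
    have "((\<lambda>s. of_real (sqrt 8) * (base_form ?vs - of_real (a s / 2) * vol4 \<zeta> v0 v1 v2 v3)) \<longlongrightarrow>
        of_real (sqrt 8) * (base_form ?vs - of_real (0 / 2) * vol4 \<zeta> v0 v1 v2 v3)) F"
      by (intro tendsto_intros lim) simp
    then have "(?G ?vs \<longlongrightarrow> of_real (sqrt 8) * (base_form ?vs - of_real (0 / 2) * vol4 \<zeta> v0 v1 v2 v3)) F"
      by (rule Lim_transform_eventually)
        (use a in \<open>eventually_elim, simp add: weighted_square flip: omega_def\<close>)
    from tendsto_unique[OF F(2) 1 this] show ?thesis by simp
  qed
  have wedge_H: "wedge 2 (fundamental_form \<zeta> H) (fundamental_form \<zeta> H) [v0, v1, v2, v3] =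
      wedge22 (\<lambda>u v. fundamental_form \<zeta> H [u, v]) (\<lambda>u v. fundamental_form \<zeta> H [u, v]) v0 v1 v2
          v3" for v0 v1 v2 v3
    by (intro wedge_2_2 fundamental_form_skew)
  \<comment> \<open>On these vectors \<zeta>^3 vanishes, so \<open>base_form\<close> is 0 and the
    upper left minor is isolated.\<close>
  have "of_real (Psi_norm H) * (2 * (H $ 1 $ 1 * H $ 2 $ 2 - H $ 1 $ 2 * H $ 2 $ 1)) = 0"
    using limit[of "vec_of 1 0 0" "vec_of \<i> 0 0" "vec_of 0 1 0" "vec_of 0 \<i> 0"]
    unfolding H_def[symmetric] wedge_H
    by (simp add: wedge22_def fundamental_form_def z_zbar_pair sum_3 base_form_def two_form_def
        field_simps)
  \<comment> \<open>On these vectors \<open>base_form\<close> does not vanish.\<close>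
  moreover have "Psi_norm H \<noteq> 0"
    using limit[of "vec_of 1 0 0" "vec_of \<i> 0 0" "vec_of 0 0 1" "vec_of 0 0 \<i>"]
    unfolding H_def[symmetric] by (auto simp: wedge22_def base_form_def two_form_def)
  ultimately have det: "H $ 1 $ 1 * H $ 2 $ 2 = H $ 1 $ 2 * H $ 2 $ 1" by simp
  have herm: "H $ l $ j = cnj (H $ j $ l)"
    and pd: "w \<noteq> 0 \<Longrightarrow> 0 < Re (\<Sum>j\<in>UNIV. \<Sum>l\<in>UNIV. H $ j $ l * w $ j * cnj (w $ l))" for j l
        and w :: "complex ^ 3"
    using pos unfolding positive_hermitian_def H_def by blast+
  have "0 < Re (H $ 2 $ 2)"
    using pd[of "vector [0, 1, 0]"] by (simp add: sum_3 vector_3 vec_eq_iff forall_3)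
  then have "H $ 2 $ 2 \<noteq> 0" by auto
  \<comment> \<open>On this vector the Hermitian form takes the value \<open>H $ 2 $ 2\<close> times
    the minor: pairing with the second column of \<open>H\<close> gives 0, with the first the
    minor.\<close>
  then have "(vector [H $ 2 $ 2, - (H $ 1 $ 2), 0] :: complex ^ 3) \<noteq> 0"
    by (simp add: vec_eq_iff forall_3 vector_3)
  from pd[OF this] have "0 < Re (H $ 2 $ 2 * (H $ 1 $ 1 * H $ 2 $ 2 - H $ 1 $ 2 * H $ 2 $ 1))"
    using herm[of 1 2] herm[of 2 2] by (simp add: sum_3 vector_3 algebra_simps)
  then show False using det by simp
qed

text \<open>Here \<open>t\<close> is the finite end of \<open>I\<close> and \<open>F\<close> a
  filter approaching it from inside. A larger interval of existence would contain \<open>t\<close>,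
  where the metric would have to continue past its degeneration.\<close>

lemma maximal_metric_matrix:
  assumes I: "open I" "is_interval I" "0 \<in> I"
    and pos: "\<And>s. s \<in> I \<Longrightarrow> 0 < a s"
    and deriv: "\<And>s. s \<in> I \<Longrightarrow> (a has_real_derivative D s) (at s)"
    and ode: "\<And>s. s \<in> I \<Longrightarrow>
      sqrt 8 * D s = \<rho>\<^sup>2 + lam\<^sup>2 - 2 * x - \<alpha>' * trace_coeff ((1 - \<tau>) / 2) / (a s)\<^sup>2"
    and ends: "\<And>I'. I \<subset> I' \<Longrightarrow> is_interval I' \<Longrightarrow> t \<in> I'"
    and F: "F \<le> at t" "F \<noteq> bot" "\<forall>\<^sub>F s in F. s \<in> I" and lim: "(a \<longlongrightarrow> 0) F"
  shows "maximal_anomaly_flow_solution br J \<zeta> \<tau> \<alpha>' I (\<lambda>s. metric_matrix (a s))"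
  unfolding maximal_anomaly_flow_solution_def
proof (intro conjI notI)
  show "anomaly_flow_solution br J \<zeta> \<tau> \<alpha>' I (\<lambda>s. metric_matrix (a s))"
    unfolding anomaly_flow_solution_def
    using I positive_hermitian_metric_matrix pos
        anomaly_flow_at_metric_matrix[OF I(1) _ pos deriv ode] by blast
next
  assume "\<exists>I' h'. I \<subset> I' \<and> anomaly_flow_solution br J \<zeta> \<tau> \<alpha>' I' h' \<and> (\<forall>t\<in>I. h' t = metric_matrix (a t))"
  then obtain I' h' where h': "I \<subset> I'" "anomaly_flow_solution br J \<zeta> \<tau> \<alpha>' I' h'"
      "\<forall>t\<in>I. h' t = metric_matrix (a t)"
    by blast
  then have "t \<in> I'" using ends unfolding anomaly_flow_solution_def by blast
  then have "anomaly_flow_at br J \<zeta> \<tau> \<alpha>' h' t" "positive_hermitian (h' t)"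
    using h'(2) unfolding anomaly_flow_solution_def by blast+
  moreover have "\<forall>\<^sub>F s in F. h' s = metric_matrix (a s) \<and> 0 < a s"
    using F(3) by eventually_elim (use h'(3) pos in blast)
  ultimately show False using anomaly_flow_no_limit_point F(1,2) lim by blast
qed

text \<open>The three values of \<open>s\<close> suffice because \<open>trace_coeff\<close> is a cubic with a root at \<open>0\<close>.\<close>

lemma exists_trace_coeff_nonzero:
  assumes "\<rho>\<^sup>2 + lam\<^sup>2 - 2 * x \<noteq> 0"
  shows "\<exists>s. trace_coeff s \<noteq> 0"
proof (rule ccontr)
  assume "\<not> ?thesis"
  then have zero: "trace_coeff 1 = 0" "trace_coeff 2 = 0" "trace_coeff (- 1) = 0" by blast+
  define K where "K = \<rho>\<^sup>2 + lam\<^sup>2 - 2 * x"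
  define q where "q = 1 + lam\<^sup>2 + x\<^sup>2 + y\<^sup>2"
  define c where "c = 2 * x * (1 + x\<^sup>2 + y\<^sup>2)"
  have tc: "trace_coeff s = s * (c * (1 - s + s\<^sup>2) - s * q * (K - 4 * \<rho>\<^sup>2 * (1 - s)))" for s
    by (simp add: trace_coeff_def K_def q_def c_def)
  have "0 < q" unfolding q_def by (simp add: add_pos_nonneg)
  \<comment> \<open>The value at 1 gives \<open>c = q * K\<close>; those at 2 and -1 then give
    \<open>K = 8 * \<rho>\<^sup>2\<close> and \<open>K = 2 * \<rho>\<^sup>2\<close>.\<close>
  then have "K = 0" using zero unfolding tc by (auto simp: algebra_simps)
  then show False using assms by (simp add: K_def)
qed

section \<open>Immortal and ancient solutions by scaling and reversing time\<close>

lemma immortal_and_ancient_solutions: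
  assumes K: "\<rho>\<^sup>2 + lam\<^sup>2 - 2 * x \<noteq> 0"
  shows "\<exists>\<tau> \<alpha>' h. \<alpha>' \<noteq> 0 \<and> immortal_solution br J \<zeta> \<tau> \<alpha>' h"
    and "\<exists>\<tau> \<alpha>' h. \<alpha>' \<noteq> 0 \<and> ancient_solution br J \<zeta> \<tau> \<alpha>' h"
proof -
  define K where "K = \<rho>\<^sup>2 + lam\<^sup>2 - 2 * x"
  obtain s where s: "trace_coeff s \<noteq> 0" using exists_trace_coeff_nonzero[OF K] by blast
  define \<tau> where "\<tau> = 1 - 2 * s"
  have \<tau>: "(1 - \<tau>) / 2 = s" by (simp add: \<tau>_def)
  define m where "m = \<bar>K\<bar> / sqrt 8"
  have m: "0 < m" "sqrt 8 * m = \<bar>K\<bar>" using K by (simp_all add: m_def K_def)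
  have ode: "\<exists>f :: real \<Rightarrow> real. (\<forall>t>0. 0 < f t \<and> (f has_real_derivative sg + 1 / (f t)\<^sup>2) (at t))
      \<and> (f \<longlongrightarrow> 0) (at_right 0)"
    if "sg = 1 \<or> sg = - 1" for sg :: real
    using that
  proof
    assume "sg = 1" then show ?thesis using ode_solution_plus by (simp only:)
  next
    assume "sg = - 1" then show ?thesis using ode_solution_minus by (simp only:)
  qed
  show "\<exists>\<tau> \<alpha>' h. \<alpha>' \<noteq> 0 \<and> immortal_solution br J \<zeta> \<tau> \<alpha>' h"
  proof -
    \<comment> \<open>This makes \<open>- \<alpha>' * trace_coeff s\<close> equal to |K| =
      \<open>sqrt 8 * m\<close>, so the flow reads a' = m (sgn K + 1/a^2).\<close>
    define \<alpha>' where "\<alpha>' = - sqrt 8 * m / trace_coeff s"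
    have "sgn K = 1 \<or> sgn K = - 1" using K by (simp add: sgn_if K_def)
    from ode[OF this] obtain f where f: "\<And>t. 0 < t \<Longrightarrow> 0 < f t"
      "\<And>t. 0 < t \<Longrightarrow> (f has_real_derivative sgn K + 1 / (f t)\<^sup>2) (at t)" "(f \<longlongrightarrow> 0) (at_right 0)"
      by blast
    \<comment> \<open>The shift places the degeneration at -1, so that 0 is an interior
      time.\<close>
    define a where "a t = f (m * (t + 1))" for t
    have "maximal_anomaly_flow_solution br J \<zeta> \<tau> \<alpha>' {- 1<..} (\<lambda>t. metric_matrix (a t))"
    proof (rule maximal_metric_matrix)
      fix t :: real assume "t \<in> {- 1<..}"
      then have t: "0 < m * (t + 1)" using m by simp
      show "0 < a t" using f(1)[OF t] by (simp add: a_def)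
      show "(a has_real_derivative (sgn K + 1 / (a t)\<^sup>2) * m) (at t)"
        unfolding a_def by (rule DERIV_chain2[where f = f
            and g = "\<lambda>t. m * (t + 1)", OF f(2)[OF t]]) (auto intro!: derivative_eq_intros)
      have "sqrt 8 * ((sgn K + 1 / (a t)\<^sup>2) * m) = (sqrt 8 * m) * sgn K + (sqrt 8 * m) / (a t)\<^sup>2"
        by (simp add: algebra_simps)
      also have "\<dots> = K - \<alpha>' * trace_coeff s / (a t)\<^sup>2"
        using s by (simp add: m(2) \<alpha>'_def abs_mult_sgn)
      finally show "sqrt 8 * ((sgn K + 1 / (a t)\<^sup>2) * m) =
          \<rho>\<^sup>2 + lam\<^sup>2 - 2 * x - \<alpha>' * trace_coeff ((1 - \<tau>) / 2) / (a t)\<^sup>2"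
        by (simp add: \<tau> K_def)
    next
      fix I' :: "real set" assume I': "{- 1<..} \<subset> I'" "is_interval I'"
      from psubset_imp_ex_mem[OF I'(1)] obtain p where p: "p \<in> I'" "p \<notin> {- 1<..}" by blast
      have 0: "0 \<in> I'" using psubset_imp_subset[OF I'(1)] by (rule subsetD) simp
      have "p \<le> - 1" using p(2) by simp
      then show "- 1 \<in> I'" by (rule mem_is_interval_1_I[OF I'(2) p(1) 0]) simp
    next
      show "(a \<longlongrightarrow> 0) (at_right (- 1))"
        unfolding a_def
      proof (rule filterlim_compose[OF f(3)])
        show "filterlim (\<lambda>t. m * (t + 1)) (at_right 0) (at_right (- 1))"
          unfolding filterlim_at
        proof
          show "\<forall>\<^sub>F t in at_right (- 1). m * (t + 1) \<in> {0<..} \<and> m * (t + 1) \<noteq> 0"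
            unfolding eventually_at_filter using m by (intro always_eventually) auto
          have "((\<lambda>t. m * (t + 1)) \<longlongrightarrow> m * (- 1 + 1)) (at_right (- 1))"
            by (intro tendsto_intros)
          then show "((\<lambda>t. m * (t + 1)) \<longlongrightarrow> 0) (at_right (- 1))" by simp
        qed
      qed
    next
      show "\<forall>\<^sub>F s in at_right (- 1). s \<in> {- 1<..}"
        unfolding eventually_at_filter by (intro always_eventually) simp
      show "at_right (- 1) \<le> at (- 1 :: real)" by (rule at_le) simp
    qed (simp_all add: is_interval_1)
    moreover have "\<alpha>' \<noteq> 0" using s m(1) by (simp add: \<alpha>'_def)
    ultimately show ?thesis unfolding immortal_solution_def using zero_less_one by blast
  qed
  show "\<exists>\<tau> \<alpha>' h. \<alpha>' \<noteq> 0 \<and> ancient_solution br J \<zeta> \<tau> \<alpha>' h"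
  proof -
    \<comment> \<open>With the opposite sign the flow reads a' = - m (- sgn K + 1/a^2), the time
      reversal of the scalar equation for \<open>- sgn K\<close>.\<close>
    define \<alpha>' where "\<alpha>' = sqrt 8 * m / trace_coeff s"
    have "- sgn K = 1 \<or> - sgn K = - 1" using K by (simp add: sgn_if K_def)
    from ode[OF this] obtain f where f: "\<And>t. 0 < t \<Longrightarrow> 0 < f t"
      "\<And>t. 0 < t \<Longrightarrow> (f has_real_derivative - sgn K + 1 / (f t)\<^sup>2) (at t)" "(f \<longlongrightarrow> 0) (at_right 0)"
      by blast
    \<comment> \<open>Time runs backwards from the degeneration, now at 1.\<close>
    define a where "a t = f (m * (1 - t))" for t
    have "maximal_anomaly_flow_solution br J \<zeta> \<tau> \<alpha>' {..<1} (\<lambda>t. metric_matrix (a t))"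
    proof (rule maximal_metric_matrix)
      fix t :: real assume "t \<in> {..<1}"
      then have t: "0 < m * (1 - t)" using m by simp
      show "0 < a t" using f(1)[OF t] by (simp add: a_def)
      show "(a has_real_derivative (- sgn K + 1 / (a t)\<^sup>2) * - m) (at t)"
        unfolding a_def by (rule DERIV_chain2[where f = f
            and g = "\<lambda>t. m * (1 - t)", OF f(2)[OF t]]) (auto intro!: derivative_eq_intros)
      have "sqrt 8 * ((- sgn K + 1 / (a t)\<^sup>2) * - m) = (sqrt 8 * m) * sgn K - (sqrt 8 * m) / (a t)\<^sup>2"
        by (simp add: algebra_simps)
      also have "\<dots> = K - \<alpha>' * trace_coeff s / (a t)\<^sup>2"
        using s by (simp add: m(2) \<alpha>'_def abs_mult_sgn)
      finally show "sqrt 8 * ((- sgn K + 1 / (a t)\<^sup>2) * - m) =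
          \<rho>\<^sup>2 + lam\<^sup>2 - 2 * x - \<alpha>' * trace_coeff ((1 - \<tau>) / 2) / (a t)\<^sup>2"
        by (simp add: \<tau> K_def)
    next
      fix I' :: "real set" assume I': "{..<1} \<subset> I'" "is_interval I'"
      from psubset_imp_ex_mem[OF I'(1)] obtain p where p: "p \<in> I'" "p \<notin> {..<1}" by blast
      have 0: "0 \<in> I'" using psubset_imp_subset[OF I'(1)] by (rule subsetD) simp
      have "1 \<le> p" using p(2) by simp
      then show "1 \<in> I'" by (rule mem_is_interval_1_I[OF I'(2) 0 p(1) zero_le_one])
    next
      show "(a \<longlongrightarrow> 0) (at_left 1)"
        unfolding a_def
      proof (rule filterlim_compose[OF f(3)])
        show "filterlim (\<lambda>t. m * (1 - t)) (at_right 0) (at_left 1)"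
          unfolding filterlim_at
        proof
          show "\<forall>\<^sub>F t in at_left 1. m * (1 - t) \<in> {0<..} \<and> m * (1 - t) \<noteq> 0"
            unfolding eventually_at_filter using m by (intro always_eventually) auto
          have "((\<lambda>t. m * (1 - t)) \<longlongrightarrow> m * (1 - 1)) (at_left 1)"
            by (intro tendsto_intros)
          then show "((\<lambda>t. m * (1 - t)) \<longlongrightarrow> 0) (at_left 1)" by simp
        qed
      qed
    next
      show "\<forall>\<^sub>F s in at_left 1. s \<in> {..<1}"
        unfolding eventually_at_filter by (intro always_eventually) simp
      show "at_left 1 \<le> at (1 :: real)" by (rule at_le) simp
    qed (simp_all add: is_interval_1)
    moreover have "\<alpha>' \<noteq> 0" using s m(1) by (simp add: \<alpha>'_def)
    ultimately show ?thesis unfolding ancient_solution_def using zero_less_one by blast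
  qed
qed

end

theorem proposition4p8:
  fixes k :: nat and J :: "V6 \<Rightarrow> V6" and \<zeta> :: "3 \<Rightarrow> V6 \<Rightarrow> complex"
    and \<rho> lam x y :: real
  assumes "k \<in> {2, 3, 4, 5, 6, 8}"
    and "complex_structure (nil_bracket k) J"
    and "coframe10 J \<zeta>"
    and "\<rho> \<in> {0, 1}" and "0 \<le> lam"
    and "structure_equations (nil_bracket k) \<zeta> \<rho> lam x y"
    and "\<rho> + lam\<^sup>2 - 2 * x \<noteq> 0"
  shows "(\<exists>\<tau> \<alpha>' h. \<alpha>' \<noteq> 0 \<and> immortal_solution (nil_bracket k) J \<zeta> \<tau> \<alpha>' h) \<and>
         (\<exists>\<tau> \<alpha>' h. \<alpha>' \<noteq> 0 \<and> ancient_solution (nil_bracket k) J \<zeta> \<tau> \<alpha>' h)"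
proof -
  interpret nilpotent_coframe "nil_bracket k" J \<zeta> \<rho> lam x y
    using assms by unfold_locales
  \<comment> \<open>The computation produces \<open>\<rho>\<^sup>2\<close> where the condition on
    K_1 has \<open>\<rho>\<close>; they agree for the normalised values 0 and 1.\<close>
  have "\<rho>\<^sup>2 = \<rho>" using assms(4) by auto
  then show ?thesis using immortal_and_ancient_solutions assms(7) by simp
qed

end
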